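(* Let $W$ be a Weyl tensor of Petrov type II, with canonical expression $\mathcal W=2\rho\,\mathcal U\otimes\mathcal U-\rho\,\mathcal L\,\tilde\otimes\,\mathcal K+\rho\,\mathcal L\otimes\mathcal L$, $\rho\neq0$, where $\{\mathcal U,\mathcal L,\mathcal K\}$ is a null frame of self-dual bivectors, and let $t=|\rho|^2$. Define $$\Pi=\mathcal U\cdot\overline{\mathcal U},\ \Lambda=\mathcal L\cdot\overline{\mathcal L},\ \mathrm K=\mathcal K\cdot\overline{\mathcal K},\ \mathrm N=\mathcal U\cdot\overline{\mathcal L},\ \Omega=\mathcal U\cdot\overline{\mathcal K},\ \mathrm M=\mathcal L\cdot\overline{\mathcal K}.$$ Then the Bel-Robinson tensor $T$ of $W$ admits the canonical expression $$\begin{aligned}T={}&4t\,\Pi\otimes\Pi-2t\,(\Omega\,\tilde\otimes\,\mathrm N+\overline\Omega\,\tilde\otimes\,\overline{\mathrm N}-\mathrm N\otimes\mathrm N-\overline{\mathrm N}\otimes\overline{\mathrm N})\\&+t\,(\Lambda\,\tilde\otimes\,\mathrm K+\mathrm M\,\tilde\otimes\,\overline{\mathrm M}-\Lambda\,\tilde\otimes\,\overline{\mathrm M}-\Lambda\,\tilde\otimes\,\mathrm M+\Lambda\otimes\Lambda).\end{aligned}$$ The eigenvalue $4t$ is simple and is associated with the eigentensor $\Pi$. Associated with the quadruple eigenvalue $t$ there are the eigentensor $\mathrm M_I$ and the invariant space $Q_t=\langle\Lambda,\mathrm M_R,\mathrm K\rangle$, in which $\Lambda$ is (up to scalar factor)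 the sole eigentensor. Associated with the quadruple eigenvalue $-2t$ there are the invariant spaces $Q_R=\langle\mathrm N_R,\Omega_R\rangle$, with $\mathrm N_R$ the sole eigentensor, and $Q_I=\langle\mathrm N_I,\Omega_I\rangle$, with $\mathrm N_I$ the sole eigentensor (up to scalar factor). Here $\Psi_R,\Psi_I$ denote the real and imaginary parts of a complex symmetric tensor $\Psi$.
   Context: $(V,g)$ is an oriented 4-dimensional real vector space with a Lorentzian metric of signature $(-,+,+,+)$ (the tangent space of a space-time at a point); indices are moved with $g$; $\eta$ is the metric volume element; $( *F)_{\alpha\beta}=\frac12\eta_{\alpha\beta\mu\nu}F^{\mu\nu}$, $( *W)_{\alpha\beta\mu\nu}=\frac12\eta_{\alpha\beta}{}^{\rho\sigma}W_{\rho\sigma\mu\nu}$. A self-dual (SD) bivector is a complex 2-form $\mathcal F$ with $*\mathcal F=\mathrm i\mathcal F$; these form a complex 3-dimensional space with metric $\mathcal G(\mathcal F,\mathcal H)=\frac12\mathcal F_{\alpha\beta}\mathcal H^{\alpha\beta}$. A null frame $\{\mathcal U,\mathcal L,\mathcal K\}$ of SD bivectors satisfies $\mathcal G(\mathcal U,\mathcal U)=-1$, $\mathcal G(\mathcal L,\mathcal K)=-1$, all other products being zero. $A\,\tilde\otimes\,B=A\otimes B+B\otimes A$. A Weyl tensor $W$ is a real 4-tensor with the algebraic symmetries of a Riemann tensor and vanishing traces; $\mathcal W=\frac12(W-\mathrm i*W)$ acts on SD bivectors by $\mathcal W(\mathcal F)_{\alpha\beta}=\frac12\mathcal W_{\alpha\beta}{}^{\mu\nu}\mathcal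 F_{\mu\nu}$. Type II means that this map has a simple eigenvalue $-2\rho$ and a double eigenvalue $\rho\ne0$ and is not diagonalizable; it is known that then the canonical expression of the claim exists. The Bel-Robinson (BR) tensor of $W$ is $T_{\alpha\mu\beta\nu}=\mathcal W_{\alpha}{}^{\rho}{}_{\beta}{}^{\sigma}\,\overline{\mathcal W}_{\mu\rho\nu\sigma}$; it is totally symmetric and traceless and acts on the 9-dimensional space of traceless symmetric 2-tensors by $T(A)_{\alpha\beta}=T_{\alpha\beta}{}^{\mu\nu}A_{\mu\nu}$; an eigentensor is an eigenvector of this map. For 2-tensors $(A\cdot B)_{\alpha\beta}=A_{\alpha}{}^{\mu}B_{\mu\beta}$. $\langle\cdot\rangle$ denotes linear span. *)

theory Defs
  imports "HOL-Analysis.Analysis"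
begin

text \<open>
  Tensors on a 4-dimensional real vector space are given by their covariant components in an
  arbitrary basis, indexed by the type \<^typ>\<open>4\<close>. Complex tensors are used throughout; a real tensor
  is identified with the complex tensor having the same components. The first index of a tensor
  is selected first: \<open>A $ a $ b\<close> is \<open>A\<^sub>a\<^sub>b\<close>.
\<close>

type_synonym tensor2 = "complex^4^4"
type_synonym tensor4 = "complex^4^4^4^4"

text \<open>The index \<^term>\<open>0 :: 4\<close> (which equals \<^term>\<open>4 :: 4\<close>) is the timelike one.\<close>

definition minkowski :: "real^4^4" where
  "minkowski = (\<chi> a b. if a \<noteq> b then 0 else if a = 0 then -1 else 1)"

text \<open>The columns of \<open>P\<close> are the vectors of an orthonormal basis.\<close>

definition lorentzian_metric :: "real^4^4 \<Rightarrow> bool" where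
  "lorentzian_metric g \<longleftrightarrow>
     transpose g = g \<and> (\<exists>P. invertible P \<and> transpose P ** g ** P = minkowski)"

definition levi_civita :: "4 \<Rightarrow> 4 \<Rightarrow> 4 \<Rightarrow> 4 \<Rightarrow> real" where
  "levi_civita a b m n = det (vector [axis a 1, axis b 1, axis m 1, axis n 1] :: real^4^4)"

text \<open>
  Each of the two orientations has its metric volume element. A choice of \<open>\<eta>\<close> with the following
  property is therefore the same as a choice of orientation.
\<close>

definition metric_volume_element :: "real^4^4 \<Rightarrow> real^4^4^4^4 \<Rightarrow> bool" where
  "metric_volume_element g \<eta> \<longleftrightarrow>
     (\<exists>s\<in>{1, -1}. \<eta> = (\<chi> a b m n. s * sqrt \<bar>det g\<bar> * levi_civita a b m n))"

definition ginv :: "real^4^4 \<Rightarrow> 4 \<Rightarrow> 4 \<Rightarrow> real" where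
  "ginv g a b = matrix_inv g $ a $ b"

text \<open>\<open>(*F)\<^sub>a\<^sub>b = 1/2 \<eta>\<^sub>a\<^sub>b\<^sub>m\<^sub>n F\<^sup>m\<^sup>n\<close>\<close>

definition hodge2 :: "real^4^4 \<Rightarrow> real^4^4^4^4 \<Rightarrow> tensor2 \<Rightarrow> tensor2" where
  "hodge2 g \<eta> F = (\<chi> a b. 1/2 * (\<Sum>m\<in>UNIV. \<Sum>n\<in>UNIV. \<Sum>p\<in>UNIV. \<Sum>q\<in>UNIV.
     complex_of_real (\<eta> $ a $ b $ m $ n * ginv g m p * ginv g n q) * F $ p $ q))"

text \<open>\<open>(*W)\<^sub>a\<^sub>b\<^sub>m\<^sub>n = 1/2 \<eta>\<^sub>a\<^sub>b\<^sup>r\<^sup>s W\<^sub>r\<^sub>s\<^sub>m\<^sub>n\<close>\<close>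

definition hodge4 :: "real^4^4 \<Rightarrow> real^4^4^4^4 \<Rightarrow> real^4^4^4^4 \<Rightarrow> real^4^4^4^4" where
  "hodge4 g \<eta> W = (\<chi> a b m n. 1/2 * (\<Sum>r\<in>UNIV. \<Sum>s\<in>UNIV. \<Sum>p\<in>UNIV. \<Sum>q\<in>UNIV.
     \<eta> $ a $ b $ p $ q * ginv g p r * ginv g q s * W $ r $ s $ m $ n))"

definition cscale2 :: "complex \<Rightarrow> tensor2 \<Rightarrow> tensor2" where
  "cscale2 c A = (\<chi> a b. c * A $ a $ b)"

lemma vector_space_cscale2: "vector_space cscale2"
  by unfold_locales (simp_all add: cscale2_def vec_eq_iff algebra_simps)

definition cscale4 :: "complex \<Rightarrow> tensor4 \<Rightarrow> tensor4" (infixr "*\<^sub>C" 75) where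
  "c *\<^sub>C A = (\<chi> a b m n. c * A $ a $ b $ m $ n)"

definition cnj2 :: "tensor2 \<Rightarrow> tensor2" where
  "cnj2 A = (\<chi> a b. cnj (A $ a $ b))"

definition Re2 :: "tensor2 \<Rightarrow> tensor2" where
  "Re2 A = (\<chi> a b. complex_of_real (Re (A $ a $ b)))"

definition Im2 :: "tensor2 \<Rightarrow> tensor2" where
  "Im2 A = (\<chi> a b. complex_of_real (Im (A $ a $ b)))"

definition tensor_prod :: "tensor2 \<Rightarrow> tensor2 \<Rightarrow> tensor4" (infixl "\<otimes>" 80) where
  "A \<otimes> B = (\<chi> a b m n. A $ a $ b * B $ m $ n)"

definition sym_tensor_prod :: "tensor2 \<Rightarrow> tensor2 \<Rightarrow> tensor4" (infixl "\<otimes>\<^sub>s" 80) where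
  "A \<otimes>\<^sub>s B = A \<otimes> B + B \<otimes> A"

text \<open>\<open>(A \<cdot> B)\<^sub>a\<^sub>b = A\<^sub>a\<^sup>m B\<^sub>m\<^sub>b\<close>\<close>

definition tdot :: "real^4^4 \<Rightarrow> tensor2 \<Rightarrow> tensor2 \<Rightarrow> tensor2" where
  "tdot g A B = (\<chi> a b. \<Sum>m\<in>UNIV. \<Sum>p\<in>UNIV.
     A $ a $ p * complex_of_real (ginv g p m) * B $ m $ b)"

text \<open>\<open>T(A)\<^sub>a\<^sub>b = T\<^sub>a\<^sub>b\<^sup>m\<^sup>n A\<^sub>m\<^sub>n\<close>\<close>

definition tensor_act :: "real^4^4 \<Rightarrow> tensor4 \<Rightarrow> tensor2 \<Rightarrow> tensor2" where
  "tensor_act g T A = (\<chi> a b. \<Sum>m\<in>UNIV. \<Sum>n\<in>UNIV. \<Sum>p\<in>UNIV. \<Sum>q\<in>UNIV.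
     T $ a $ b $ p $ q * complex_of_real (ginv g p m * ginv g q n) * A $ m $ n)"

text \<open>The traceless symmetric real 2-tensors, a real vector space of dimension 9.\<close>

definition traceless_symmetric :: "real^4^4 \<Rightarrow> tensor2 set" where
  "traceless_symmetric g = {A. (\<forall>a b. A $ a $ b \<in> \<real>) \<and> (\<forall>a b. A $ a $ b = A $ b $ a) \<and>
     (\<Sum>a\<in>UNIV. \<Sum>b\<in>UNIV. complex_of_real (ginv g a b) * A $ a $ b) = 0}"

definition SD_bivectors :: "real^4^4 \<Rightarrow> real^4^4^4^4 \<Rightarrow> tensor2 set" where
  "SD_bivectors g \<eta> = {F. (\<forall>a b. F $ a $ b = - F $ b $ a) \<and> hodge2 g \<eta> F = cscale2 \<i> F}"

text \<open>\<open>\<G>(F, H) = 1/2 F\<^sub>a\<^sub>b H\<^sup>a\<^sup>b\<close>\<close>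

definition SD_metric :: "real^4^4 \<Rightarrow> tensor2 \<Rightarrow> tensor2 \<Rightarrow> complex" where
  "SD_metric g F H = 1/2 * (\<Sum>a\<in>UNIV. \<Sum>b\<in>UNIV. \<Sum>m\<in>UNIV. \<Sum>n\<in>UNIV.
     F $ a $ b * complex_of_real (ginv g a m * ginv g b n) * H $ m $ n)"

definition null_frame ::
  "real^4^4 \<Rightarrow> real^4^4^4^4 \<Rightarrow> tensor2 \<Rightarrow> tensor2 \<Rightarrow> tensor2 \<Rightarrow> bool" where
  "null_frame g \<eta> U L K \<longleftrightarrow>
     {U, L, K} \<subseteq> SD_bivectors g \<eta> \<and>
     SD_metric g U U = -1 \<and> SD_metric g L K = -1 \<and>
     SD_metric g U L = 0 \<and> SD_metric g U K = 0 \<and>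
     SD_metric g L L = 0 \<and> SD_metric g K K = 0"

text \<open>
  The parameter \<open>smul\<close> is the scalar multiplication, \<open>f\<close> a linear map and \<open>S\<close> a finite-dimensional
  subspace invariant under \<open>f\<close>. Multiplicities of eigenvalues are algebraic multiplicities.
\<close>

definition eigenvector_on ::
  "('k::field \<Rightarrow> 'v::ab_group_add \<Rightarrow> 'v) \<Rightarrow> ('v \<Rightarrow> 'v) \<Rightarrow> 'v set \<Rightarrow> 'k \<Rightarrow> 'v \<Rightarrow> bool" where
  "eigenvector_on smul f S c x \<longleftrightarrow> x \<in> S \<and> x \<noteq> 0 \<and> f x = smul c x"

definition gen_eigenspace ::
  "('k::field \<Rightarrow> 'v::ab_group_add \<Rightarrow> 'v) \<Rightarrow> ('v \<Rightarrow> 'v) \<Rightarrow> 'v set \<Rightarrow> 'k \<Rightarrow> 'v set" where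
  "gen_eigenspace smul f S c = {x \<in> S. \<exists>n. ((\<lambda>y. f y - smul c y) ^^ n) x = 0}"

definition alg_mult ::
  "('k::field \<Rightarrow> 'v::ab_group_add \<Rightarrow> 'v) \<Rightarrow> ('v \<Rightarrow> 'v) \<Rightarrow> 'v set \<Rightarrow> 'k \<Rightarrow> nat" where
  "alg_mult smul f S c = vector_space.dim smul (gen_eigenspace smul f S c)"

definition diagonalizable_on ::
  "('k::field \<Rightarrow> 'v::ab_group_add \<Rightarrow> 'v) \<Rightarrow> ('v \<Rightarrow> 'v) \<Rightarrow> 'v set \<Rightarrow> bool" where
  "diagonalizable_on smul f S \<longleftrightarrow>
     (\<exists>B. \<not> module.dependent smul B \<and> module.span smul B = S \<and>
        (\<forall>b\<in>B. \<exists>c. eigenvector_on smul f S c b))"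

definition invariant_space :: "('v::real_vector \<Rightarrow> 'v) \<Rightarrow> 'v set \<Rightarrow> bool" where
  "invariant_space f Q \<longleftrightarrow> subspace Q \<and> f ` Q \<subseteq> Q"

text \<open>Uniqueness of \<open>x\<close> is up to a scalar factor and among the eigenvectors for all eigenvalues.\<close>

definition sole_eigenvector :: "('v::real_vector \<Rightarrow> 'v) \<Rightarrow> 'v set \<Rightarrow> 'v \<Rightarrow> bool" where
  "sole_eigenvector f Q x \<longleftrightarrow>
     {y. \<exists>c. eigenvector_on scaleR f Q c y} = {k *\<^sub>R x | k. k \<noteq> 0}"

definition weyl_tensor :: "real^4^4 \<Rightarrow> real^4^4^4^4 \<Rightarrow> bool" where
  "weyl_tensor g W \<longleftrightarrow>
     (\<forall>a b m n. W $ a $ b $ m $ n = - W $ b $ a $ m $ n) \<and>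
     (\<forall>a b m n. W $ a $ b $ m $ n = - W $ a $ b $ n $ m) \<and>
     (\<forall>a b m n. W $ a $ b $ m $ n = W $ m $ n $ a $ b) \<and>
     (\<forall>a b m n. W $ a $ b $ m $ n + W $ a $ m $ n $ b + W $ a $ n $ b $ m = 0) \<and>
     (\<forall>b n. (\<Sum>a\<in>UNIV. \<Sum>m\<in>UNIV. ginv g a m * W $ a $ b $ m $ n) = 0)"

text \<open>\<open>\<W> = 1/2 (W - i *W)\<close>\<close>

definition SD_weyl :: "real^4^4 \<Rightarrow> real^4^4^4^4 \<Rightarrow> real^4^4^4^4 \<Rightarrow> tensor4" where
  "SD_weyl g \<eta> W = (\<chi> a b m n. 1/2 * (complex_of_real (W $ a $ b $ m $ n)
     - \<i> * complex_of_real (hodge4 g \<eta> W $ a $ b $ m $ n)))"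

definition weyl_map ::
  "real^4^4 \<Rightarrow> real^4^4^4^4 \<Rightarrow> real^4^4^4^4 \<Rightarrow> tensor2 \<Rightarrow> tensor2" where
  "weyl_map g \<eta> W F = cscale2 (1/2) (tensor_act g (SD_weyl g \<eta> W) F)"

definition petrov_type_II :: "real^4^4 \<Rightarrow> real^4^4^4^4 \<Rightarrow> real^4^4^4^4 \<Rightarrow> bool" where
  "petrov_type_II g \<eta> W \<longleftrightarrow>
     (\<exists>\<rho>. \<rho> \<noteq> 0 \<and>
        alg_mult cscale2 (weyl_map g \<eta> W) (SD_bivectors g \<eta>) (- 2 * \<rho>) = 1 \<and>
        alg_mult cscale2 (weyl_map g \<eta> W) (SD_bivectors g \<eta>) \<rho> = 2 \<and>
        \<not> diagonalizable_on cscale2 (weyl_map g \<eta> W) (SD_bivectors g \<eta>))"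

text \<open>\<open>T\<^sub>a\<^sub>m\<^sub>b\<^sub>n = \<W>\<^sub>a\<^sup>r\<^sub>b\<^sup>s cnj \<W>\<^sub>m\<^sub>r\<^sub>n\<^sub>s\<close>\<close>

definition bel_robinson :: "real^4^4 \<Rightarrow> real^4^4^4^4 \<Rightarrow> real^4^4^4^4 \<Rightarrow> tensor4" where
  "bel_robinson g \<eta> W = (\<chi> a m b n. \<Sum>r\<in>UNIV. \<Sum>s\<in>UNIV. \<Sum>p\<in>UNIV. \<Sum>q\<in>UNIV.
     SD_weyl g \<eta> W $ a $ p $ b $ q * complex_of_real (ginv g p r * ginv g q s) *
     cnj (SD_weyl g \<eta> W $ m $ r $ n $ s))"

end

theory Submission
  imports Defs
begin

text \<open>
  Self-dual bivectors satisfy the Clifford relation \<open>X \<cdot> Y + Y \<cdot> X = - \<G>(X, Y) g\<close> and commute with the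
  anti-self-dual ones; both are read off from explicit matrices in an orthonormal basis. Hence the
  tensors \<open>X \<cdot> cnj Y\<close> are symmetric and traceless, and their full contractions factorise:
  \<open>(X \<cdot> cnj Y, Z \<cdot> cnj V) = \<G>(X, Z) * cnj \<G>(Y, V)\<close>. Substituting the canonical form of the Weyl tensor
  into the Bel-Robinson tensor gives its canonical expression, and the factorisation turns its action
  on the nine products of the null frame into Jordan blocks. The Gram matrix of these nine tensors
  and \<open>g\<close> shows that the ten are independent, hence span the real symmetric tensors, so the nine span
  the traceless ones and the generalised eigenspaces can be read off.
\<close>

section \<open>Generalised eigenspaces and Jordan blocks\<close>

text \<open>Let w be the action of the Weyl tensor on self-dual bivectors. By the factorised
  contraction, \<open>T\<close> sends X \<cdot> cnj Y to w(X) \<cdot> cnj w(Y). The canonical form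
  gives w(U) = -2\<rho>U, w(L) = \<rho>L and w(K) = \<rho>K - \<rho>L, so the eigenvalues of
  \<open>T\<close> are products of one of -2\<rho>, \<rho>, \<rho> with the conjugate of one of
  them: 4t once, -2t four times, t four times. The term -\<rho>L is the source of every nilpotent
  part. Conjugation turns X \<cdot> cnj Y into Y \<cdot> cnj X. Passing to real and imaginary parts
  is what splits -2t into two blocks of length 2, and t into a block of length 3 and a single
  eigentensor. As \<open>T\<close> is not diagonalizable, exhibiting eigentensors does not give
  multiplicities: it must be excluded that further tensors are killed by a power of T - c, and this
  takes a basis of the whole traceless space. The metric is given in an arbitrary basis and the
  orientation is free. Explicit matrices therefore serve only to establish a Clifford relation, a
  commutation rule and a vanishing trace; the later computations with the frame rest on
  these.\<close>

lemma linear_minus_scaleR: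
  fixes f :: "'v::real_vector \<Rightarrow> 'v"
  assumes "linear f"
  shows "linear (\<lambda>y. f y - c *\<^sub>R y)"
  using assms by (intro linear_compose_sub linear_compose_scale_right linear_ident)

lemma linear_funpow:
  fixes f :: "'v::real_vector \<Rightarrow> 'v"
  assumes "linear f"
  shows "linear (f ^^ n)"
  using assms by (induction n) (auto simp: linear_id[unfolded id_def] id_def intro: linear_compose[unfolded o_def] simp: o_def)

lemma funpow_commute:
  assumes "\<And>y. f (g y) = g (f y)"
  shows "(f ^^ m) ((g ^^ n) x) = (g ^^ n) ((f ^^ m) x)"
proof -
  have 1: "f ((g ^^ n) y) = (g ^^ n) (f y)" for y
    by (induction n) (simp_all add: assms)
  show ?thesis
    by (induction m) (simp_all add: 1)
qed

text \<open>The image of x under f - \<beta> satisfies the hypotheses with a smaller exponent, hence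
  vanishes by induction. Then f - \<alpha> multiplies x by the nonzero number \<beta> - \<alpha>,
  and no power of it can kill a nonzero x.\<close>

lemma coprime_kernels:
  fixes f :: "'v::real_vector \<Rightarrow> 'v"
  assumes lin: "linear f" and ne: "\<alpha> \<noteq> \<beta>"
    and "((\<lambda>y. f y - \<alpha> *\<^sub>R y) ^^ m) x = 0" and "((\<lambda>y. f y - \<beta> *\<^sub>R y) ^^ n) x = 0"
  shows "x = 0"
  using assms(3,4)
proof (induction n arbitrary: x)
  case 0
  then show ?case by simp
next
  case (Suc n)
  let ?A = "\<lambda>y. f y - \<alpha> *\<^sub>R y" and ?B = "\<lambda>y. f y - \<beta> *\<^sub>R y"
  have comm: "?A (?B y) = ?B (?A y)" for y
    by (simp add: linear_diff[OF lin] linear_scale[OF lin] algebra_simps)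
  have "(?A ^^ m) (?B x) = ?B ((?A ^^ m) x)"
    using funpow_commute[of ?A ?B m 1 x, OF comm] by simp
  then have "(?A ^^ m) (?B x) = 0"
    using Suc.prems(1) by (simp add: linear_0[OF lin])
  moreover have "(?B ^^ n) (?B x) = 0"
    using Suc.prems(2) by (simp only: funpow_Suc_right o_apply)
  ultimately have "?B x = 0" by (rule Suc.IH)
  then have "?A x = (\<beta> - \<alpha>) *\<^sub>R x"
    by (simp add: algebra_simps)
  then have "(?A ^^ k) x = (\<beta> - \<alpha>) ^ k *\<^sub>R x" for k
  proof (induction k)
    case (Suc k)
    have "(?A ^^ Suc k) x = ?A ((\<beta> - \<alpha>) ^ k *\<^sub>R x)" using Suc by simp
    also have "\<dots> = (\<beta> - \<alpha>) ^ k *\<^sub>R ?A x"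
      by (simp add: linear_scale[OF lin] algebra_simps)
    finally show ?case using Suc.prems by simp
  qed simp
  with Suc.prems(1) ne show ?case by simp
qed

text \<open>Once the \<open>A\<close>-component is subtracted, the rest y = b + c is killed by a
  power of f - \<alpha> and by (f - \<beta>)^m (f - \<gamma>)^n. Two uses of
  \<open>coprime_kernels\<close> strip off these two factors one at a time, so y = 0.\<close>

lemma gen_eigenspace_eq_summand:
  fixes f :: "'v::real_vector \<Rightarrow> 'v"
  assumes lin: "linear f" and ne: "\<alpha> \<noteq> \<beta>" "\<alpha> \<noteq> \<gamma>"
    and S: "\<And>x. x \<in> S \<Longrightarrow> \<exists>a\<in>A. \<exists>b\<in>B. \<exists>c\<in>C. x = a + (b + c)" and "A \<subseteq> S"
    and A: "\<And>x. x \<in> A \<Longrightarrow> ((\<lambda>y. f y - \<alpha> *\<^sub>R y) ^^ k) x = 0"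
    and B: "\<And>x. x \<in> B \<Longrightarrow> ((\<lambda>y. f y - \<beta> *\<^sub>R y) ^^ m) x = 0"
    and C: "\<And>x. x \<in> C \<Longrightarrow> ((\<lambda>y. f y - \<gamma> *\<^sub>R y) ^^ n) x = 0"
  shows "gen_eigenspace scaleR f S \<alpha> = A"
proof
  show "A \<subseteq> gen_eigenspace scaleR f S \<alpha>"
    using A \<open>A \<subseteq> S\<close> by (auto simp: gen_eigenspace_def)
  show "gen_eigenspace scaleR f S \<alpha> \<subseteq> A"
  proof
    fix x assume "x \<in> gen_eigenspace scaleR f S \<alpha>"
    let ?F = "\<lambda>c y. f y - c *\<^sub>R y"
    have linF: "linear (?F c ^^ i)" for c i
      by (intro linear_funpow linear_minus_scaleR lin)
    have comm: "(?F c ^^ i) ((?F d ^^ j) y) = (?F d ^^ j) ((?F c ^^ i) y)" for c d i j y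
      by (rule funpow_commute) (simp add: linear_diff[OF lin] linear_scale[OF lin] algebra_simps)
    obtain l where "x \<in> S" and l: "(?F \<alpha> ^^ l) x = 0"
      using \<open>x \<in> gen_eigenspace scaleR f S \<alpha>\<close> by (auto simp: gen_eigenspace_def)
    obtain a b c where abc: "a \<in> A" "b \<in> B" "c \<in> C" "x = a + (b + c)"
      using S[OF \<open>x \<in> S\<close>] by blast
    define y where "y = b + c"
    \<comment> \<open>The power l kills x and the power k kills a, so k + l serves for both and
      hence for y = x - a.\<close>
    have y: "(?F \<alpha> ^^ (k + l)) y = 0"
    proof -
      have "(?F \<alpha> ^^ (k + l)) x = 0"
        by (simp add: funpow_add l linear_0[OF linF])
      moreover have "(?F \<alpha> ^^ (k + l)) a = 0"
        by (subst add.commute) (simp add: funpow_add A[OF abc(1)] linear_0[OF linF])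
      ultimately show ?thesis
        by (simp add: abc(4) y_def linear_add[OF linF])
    qed
    have "(?F \<beta> ^^ m) ((?F \<gamma> ^^ n) y) = (?F \<gamma> ^^ n) ((?F \<beta> ^^ m) b) + (?F \<beta> ^^ m) ((?F \<gamma> ^^ n) c)"
      by (simp add: y_def linear_add[OF linF] comm)
    then have "(?F \<beta> ^^ m) ((?F \<gamma> ^^ n) y) = 0"
      by (simp add: B[OF abc(2)] C[OF abc(3)] linear_0[OF linF])
    moreover have "(?F \<alpha> ^^ (k + l)) ((?F \<gamma> ^^ n) y) = 0"
      by (subst comm) (simp only: y linear_0[OF linF])
    ultimately have "(?F \<gamma> ^^ n) y = 0"
      using coprime_kernels[OF lin ne(1)] by blast
    then have "y = 0"
      using coprime_kernels[OF lin ne(2) y] by blast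
    then show "x \<in> A"
      using abc by (simp add: y_def)
  qed
qed

lemma nilpotent_on_span:
  fixes f :: "'v::real_vector \<Rightarrow> 'v"
  assumes lin: "linear f" and "\<And>x. x \<in> B \<Longrightarrow> ((\<lambda>y. f y - \<alpha> *\<^sub>R y) ^^ k) x = 0"
    and "x \<in> span B"
  shows "((\<lambda>y. f y - \<alpha> *\<^sub>R y) ^^ k) x = 0"
  by (rule linear_eq_0_on_span[OF linear_funpow[OF linear_minus_scaleR[OF lin]] assms(2,3)])

lemma invariant_space_span:
  fixes f :: "'v::real_vector \<Rightarrow> 'v"
  assumes lin: "linear f" and "\<And>x. x \<in> B \<Longrightarrow> f x \<in> span B"
  shows "invariant_space f (span B)"
proof -
  have "f ` span B = span (f ` B)"
    using linear_span_image[OF lin, of B] by simp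
  also have "\<dots> \<subseteq> span B"
    using assms(2) by (intro span_minimal) auto
  finally show ?thesis by (simp add: invariant_space_def)
qed

text \<open>A power of f - \<alpha> vanishes on \<open>Q\<close>, so \<open>coprime_kernels\<close>,
  with exponent 1 for the eigenvector, leaves \<alpha> as the only possible eigenvalue. It remains
  to know the kernel of f - \<alpha> in \<open>Q\<close>.\<close>

lemma sole_eigenvectorI:
  fixes f :: "'v::real_vector \<Rightarrow> 'v"
  assumes lin: "linear f" and x: "x \<in> Q" "x \<noteq> 0" "f x = \<alpha> *\<^sub>R x" and "subspace Q"
    and nil: "\<And>y. y \<in> Q \<Longrightarrow> ((\<lambda>y. f y - \<alpha> *\<^sub>R y) ^^ k) y = 0"
    and ker: "\<And>y. y \<in> Q \<Longrightarrow> f y - \<alpha> *\<^sub>R y = 0 \<Longrightarrow> \<exists>c. y = c *\<^sub>R x"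
  shows "sole_eigenvector f Q x"
  unfolding sole_eigenvector_def
proof (intro equalityI subsetI)
  fix y assume "y \<in> {y. \<exists>c. eigenvector_on scaleR f Q c y}"
  then obtain c where y: "y \<in> Q" "y \<noteq> 0" "f y = c *\<^sub>R y"
    by (auto simp: eigenvector_on_def)
  have "c = \<alpha>"
  proof (rule ccontr)
    assume "c \<noteq> \<alpha>"
    have "((\<lambda>y. f y - c *\<^sub>R y) ^^ 1) y = 0" using y by simp
    from coprime_kernels[OF lin \<open>c \<noteq> \<alpha>\<close> this nil[OF y(1)]] y(2) show False by simp
  qed
  then obtain k where "y = k *\<^sub>R x" using ker[OF y(1)] y(3) by auto
  with y(2) show "y \<in> {k *\<^sub>R x | k. k \<noteq> 0}" by auto
next
  fix y assume "y \<in> {k *\<^sub>R x | k. k \<noteq> 0}"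
  then obtain k where "y = k *\<^sub>R x" "k \<noteq> 0" by auto
  then have "eigenvector_on scaleR f Q \<alpha> y"
    using x \<open>subspace Q\<close> by (auto simp: eigenvector_on_def subspace_scale linear_scale[OF lin])
  then show "y \<in> {y. \<exists>c. eigenvector_on scaleR f Q c y}" by auto
qed

lemma jordan_block_2:
  fixes f :: "'v::real_vector \<Rightarrow> 'v"
  assumes lin: "linear f" and ind: "independent {x, y}" and ne: "x \<noteq> y"
    and x: "f x = \<alpha> *\<^sub>R x" and y: "f y = \<alpha> *\<^sub>R y + \<beta> *\<^sub>R x" and \<beta>: "\<beta> \<noteq> 0"
  shows "invariant_space f (span {x, y})" "dim (span {x, y}) = 2"
    "sole_eigenvector f (span {x, y}) x"
    "\<And>z. z \<in> span {x, y} \<Longrightarrow> ((\<lambda>v. f v - \<alpha> *\<^sub>R v) ^^ 2) z = 0"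
proof -
  show "invariant_space f (span {x, y})"
    by (rule invariant_space_span[OF lin]) (auto simp: x y span_add span_scale span_base)
  show "dim (span {x, y}) = 2"
    using ne by (simp only: dim_span_eq_card_independent[OF ind]) simp
  have x0: "x \<noteq> 0" using ind dependent_zero[of "{x, y}"] by auto
  have nil: "((\<lambda>v. f v - \<alpha> *\<^sub>R v) ^^ 2) z = 0" if "z \<in> span {x, y}" for z
    by (rule nilpotent_on_span[OF lin _ that])
       (auto simp: numeral_2_eq_2 x y linear_scale[OF lin] linear_0[OF lin])
  then show "\<And>z. z \<in> span {x, y} \<Longrightarrow> ((\<lambda>v. f v - \<alpha> *\<^sub>R v) ^^ 2) z = 0" .
  show "sole_eigenvector f (span {x, y}) x"
  proof (rule sole_eigenvectorI[OF lin _ x0 x subspace_span nil])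
    fix z assume "z \<in> span {x, y}" and z: "f z - \<alpha> *\<^sub>R z = 0"
    then obtain a b where ab: "z = a *\<^sub>R x + b *\<^sub>R y"
      by (auto simp: span_insert span_singleton algebra_simps)
    then have "(b * \<beta>) *\<^sub>R x = 0"
      using z by (simp add: linear_add[OF lin] linear_scale[OF lin] x y algebra_simps)
    then show "\<exists>c. z = c *\<^sub>R x" using ab x0 \<beta> by auto
  qed (auto intro: span_base)
qed

text \<open>The entries above the diagonal are not normalised, because the null frame does not
  produce normalised blocks. Nonzero \<beta> and \<gamma> make this a single block whatever the
  corner entry \<delta> is.\<close>

lemma jordan_block_3:
  fixes f :: "'v::real_vector \<Rightarrow> 'v"
  assumes lin: "linear f" and ind: "independent {x, y, z}" and ne: "x \<noteq> y" "x \<noteq> z" "y \<noteq> z"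
    and x: "f x = \<alpha> *\<^sub>R x" and y: "f y = \<alpha> *\<^sub>R y + \<beta> *\<^sub>R x"
    and z: "f z = \<alpha> *\<^sub>R z + \<gamma> *\<^sub>R y + \<delta> *\<^sub>R x" and nz: "\<beta> \<noteq> 0" "\<gamma> \<noteq> 0"
  shows "invariant_space f (span {x, y, z})" "dim (span {x, y, z}) = 3"
    "sole_eigenvector f (span {x, y, z}) x"
    "\<And>w. w \<in> span {x, y, z} \<Longrightarrow> ((\<lambda>v. f v - \<alpha> *\<^sub>R v) ^^ 3) w = 0"
proof -
  show "invariant_space f (span {x, y, z})"
    by (rule invariant_space_span[OF lin]) (auto simp: x y z span_add span_scale span_base)
  show "dim (span {x, y, z}) = 3"
    using ne by (simp only: dim_span_eq_card_independent[OF ind]) simp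
  have x0: "x \<noteq> 0" using ind dependent_zero[of "{x, y, z}"] by auto
  have nil: "((\<lambda>v. f v - \<alpha> *\<^sub>R v) ^^ 3) w = 0" if "w \<in> span {x, y, z}" for w
    by (rule nilpotent_on_span[OF lin _ that])
       (auto simp: numeral_3_eq_3 x y z linear_scale[OF lin] linear_0[OF lin] linear_add[OF lin]
          algebra_simps)
  then show "\<And>w. w \<in> span {x, y, z} \<Longrightarrow> ((\<lambda>v. f v - \<alpha> *\<^sub>R v) ^^ 3) w = 0" .
  show "sole_eigenvector f (span {x, y, z}) x"
  proof (rule sole_eigenvectorI[OF lin _ x0 x subspace_span nil])
    fix w assume "w \<in> span {x, y, z}" and w: "f w - \<alpha> *\<^sub>R w = 0"
    then obtain a b c where abc: "w = a *\<^sub>R x + b *\<^sub>R y + c *\<^sub>R z"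
      by (auto simp: span_insert span_singleton algebra_simps)
    \<comment> \<open>Applying f - \<alpha> to w leaves a relation between x and y alone: their
      independence gives c = 0, and then b = 0.\<close>
    have xy: "(b * \<beta> + c * \<delta>) *\<^sub>R x + (c * \<gamma>) *\<^sub>R y = 0"
      using w by (simp add: abc linear_add[OF lin] linear_scale[OF lin] x y z algebra_simps)
    have "independent {y, x}"
      by (rule independent_mono[OF ind]) auto
    then have "y \<notin> span {x}"
      using ne by (simp add: independent_insert)
    then have "c = 0"
    proof (rule contrapos_np)
      assume "c \<noteq> 0"
      have "y = (- (b * \<beta> + c * \<delta>) / (c * \<gamma>)) *\<^sub>R x"
        using xy \<open>c \<noteq> 0\<close> nz
        by (metis (no_types, lifting) add.inverse_unique add.commute divide_inverse_commute
            mult_eq_0_iff real_vector.scale_minus_left scaleR_right_imp_eq real_vector_affinity_eq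
            scaleR_scaleR vector_fraction_eq_iff)
      then show "y \<in> span {x}"
        by (metis singletonI span_base span_scale)
    qed
    with xy have "b = 0" using x0 nz by simp
    then show "\<exists>c. w = c *\<^sub>R x" using abc \<open>c = 0\<close> by auto
  qed (auto intro: span_base)
qed

text \<open>The functionals form a dual family up to nonzero factors: applying
  \<open>\<phi> i\<close> to a vanishing combination isolates its i-th coefficient. Injectivity
  follows from the same values and allows the vectors to be counted.\<close>

lemma independent_by_duality:
  fixes b :: "nat \<Rightarrow> 'v::real_vector" and \<phi> :: "nat \<Rightarrow> 'v \<Rightarrow> real"
  assumes lin: "\<And>i. i < n \<Longrightarrow> linear (\<phi> i)"
    and diag: "\<And>i. i < n \<Longrightarrow> \<phi> i (b i) \<noteq> 0"
    and off: "\<And>i j. i < n \<Longrightarrow> j < n \<Longrightarrow> i \<noteq> j \<Longrightarrow> \<phi> i (b j) = 0"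
  shows "independent (b ` {..<n})" "inj_on b {..<n}"
proof -
  show inj: "inj_on b {..<n}"
    using diag off by (intro inj_onI) (metis lessThan_iff)
  have "u (b i) = 0" if "(\<Sum>v\<in>b ` {..<n}. u v *\<^sub>R v) = 0" "i < n" for u i
  proof -
    have "0 = \<phi> i (\<Sum>j<n. u (b j) *\<^sub>R b j)"
      using that by (simp add: sum.reindex[OF inj] linear_0[OF lin])
    also have "\<dots> = (\<Sum>j<n. u (b j) * \<phi> i (b j))"
      using that lin by (simp add: linear_sum linear_scale)
    also have "\<dots> = u (b i) * \<phi> i (b i)"
      using that by (subst sum.remove[of _ i]) (auto intro!: sum.neutral simp: off)
    finally show ?thesis using diag[OF that(2)] by simp
  qed
  then show "independent (b ` {..<n})"
    by (auto simp: dependent_finite)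
qed

lemma alg_mult_real:
  fixes f :: "'v::real_vector \<Rightarrow> 'v"
  shows "alg_mult scaleR f S c = dim (gen_eigenspace scaleR f S c)"
  by (simp add: alg_mult_def dim_raw_def)

lemma span_Un_span: "span (span A \<union> span B) = span (A \<union> B)"
  by (simp add: span_Un real_vector.span_span)

lemma span_insert_span: "span (insert a (span B)) = span (insert a B)"
  using span_Un[of "{a}" "span B"] span_Un[of "{a}" B] by (simp add: real_vector.span_span)

section \<open>Self-dual bivectors in an orthonormal basis\<close>

definition cmat :: "real^'n^'m \<Rightarrow> complex^'n^'m" where
  "cmat A = (\<chi> i j. complex_of_real (A $ i $ j))"

lemma cmat_nth [simp]: "cmat A $ i $ j = complex_of_real (A $ i $ j)"
  by (simp add: cmat_def)

lemma cmat_mult: "cmat (A ** B) = cmat A ** cmat B"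
  by (simp add: vec_eq_iff matrix_matrix_mult_def)

lemma cmat_transpose: "cmat (transpose A) = transpose (cmat A)"
  by (simp add: vec_eq_iff transpose_def)

lemma cmat_mat: "cmat (mat 1) = mat 1"
  by (simp add: vec_eq_iff mat_def)

lemma minkowski_sq: "minkowski ** minkowski = mat 1"
  by (simp add: vec_eq_iff matrix_matrix_mult_def minkowski_def mat_def forall_4 sum_4)

lemma transpose_minkowski: "transpose minkowski = minkowski"
  by (auto simp: vec_eq_iff transpose_def minkowski_def)

section \<open>Determinants and the Levi-Civita symbol\<close>

lemma det_4:
  "det (A::'a::comm_ring_1^4^4) =
    A$1$1 * (A$2$2 * (A$3$3 * A$4$4 - A$3$4 * A$4$3) - A$2$3 * (A$3$2 * A$4$4 - A$3$4 * A$4$2) + A$2$4 * (A$3$2 * A$4$3 - A$3$3 * A$4$2))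
  - A$1$2 * (A$2$1 * (A$3$3 * A$4$4 - A$3$4 * A$4$3) - A$2$3 * (A$3$1 * A$4$4 - A$3$4 * A$4$1) + A$2$4 * (A$3$1 * A$4$3 - A$3$3 * A$4$1))
  + A$1$3 * (A$2$1 * (A$3$2 * A$4$4 - A$3$4 * A$4$2) - A$2$2 * (A$3$1 * A$4$4 - A$3$4 * A$4$1) + A$2$4 * (A$3$1 * A$4$2 - A$3$2 * A$4$1))
  - A$1$4 * (A$2$1 * (A$3$2 * A$4$3 - A$3$3 * A$4$2) - A$2$2 * (A$3$1 * A$4$3 - A$3$3 * A$4$1) + A$2$3 * (A$3$1 * A$4$2 - A$3$2 * A$4$1))"
proof -
  have f: "finite {2::4, 3, 4}" "1 \<notin> {2::4, 3, 4}" "finite {3::4, 4}" "2 \<notin> {3::4, 4}"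
    "finite {4::4}" "3 \<notin> {4::4}"
    by auto
  show ?thesis
    unfolding det_def UNIV_4
    unfolding sum_over_permutations_insert[OF f(1,2)]
    unfolding sum_over_permutations_insert[OF f(3,4)]
    unfolding sum_over_permutations_insert[OF f(5,6)]
    unfolding permutes_sing
    by (simp add: sign_swap_id permutation_swap_id sign_compose sign_id swap_id_eq
        permutation_compose algebra_simps)
qed

lemma vector_4 [simp]:
  "(vector [w, x, y, z] :: 'a::zero^4) $ 1 = w" "(vector [w, x, y, z] :: 'a^4) $ 2 = x"
  "(vector [w, x, y, z] :: 'a^4) $ 3 = y" "(vector [w, x, y, z] :: 'a^4) $ 4 = z"
  by (simp_all add: vector_def)

text \<open>Multilinearity: each row in turn is expanded in the standard basis.\<close>

lemma det_vector_4:
  "det (vector [u, v, w, z] :: 'a::comm_ring_1^4^4) =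
     (\<Sum>a\<in>UNIV. \<Sum>b\<in>UNIV. \<Sum>m\<in>UNIV. \<Sum>n\<in>UNIV.
        u $ a * v $ b * w $ m * z $ n *
        det (vector [axis a 1, axis b 1, axis m 1, axis n 1] :: 'a^4^4))"
proof -
  have row: "det (vector [x, v, w, z] :: 'a^4^4) = (\<Sum>a\<in>UNIV. x $ a * det (vector [axis a 1, v, w, z] :: 'a^4^4))"
     "det (vector [v, x, w, z] :: 'a^4^4) = (\<Sum>a\<in>UNIV. x $ a * det (vector [v, axis a 1, w, z] :: 'a^4^4))"
     "det (vector [v, w, x, z] :: 'a^4^4) = (\<Sum>a\<in>UNIV. x $ a * det (vector [v, w, axis a 1, z] :: 'a^4^4))"
     "det (vector [v, w, z, x] :: 'a^4^4) = (\<Sum>a\<in>UNIV. x $ a * det (vector [v, w, z, axis a 1] :: 'a^4^4))"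
    for x v w z
    by (simp_all add: det_4 sum_4 axis_def algebra_simps)
  show ?thesis
    by (subst row(1), rule sum.cong[OF refl],
        subst row(2), unfold sum_distrib_left, rule sum.cong[OF refl],
        subst row(3), unfold sum_distrib_left, rule sum.cong[OF refl],
        subst row(4), unfold sum_distrib_left, rule sum.cong[OF refl])
       (simp add: algebra_simps)
qed

lemma sum_swap_4_2:
  fixes t :: "'a \<Rightarrow> 'b \<Rightarrow> 'c \<Rightarrow> 'd \<Rightarrow> 'e \<Rightarrow> 'f \<Rightarrow> 'g::comm_monoid_add"
  shows "(\<Sum>a\<in>A. \<Sum>b\<in>B. \<Sum>m\<in>C. \<Sum>n\<in>D. \<Sum>p\<in>E. \<Sum>q\<in>F. t a b m n p q) =
    (\<Sum>p\<in>E. \<Sum>q\<in>F. \<Sum>a\<in>A. \<Sum>b\<in>B. \<Sum>m\<in>C. \<Sum>n\<in>D. t a b m n p q)"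
  by (simp only: sum.swap[where A=D and B=E] sum.swap[where A=C and B=E] sum.swap[where A=B and B=E] sum.swap[where A=A and B=E] sum.swap[where A=D and B=F] sum.swap[where A=C and B=F] sum.swap[where A=B and B=F] sum.swap[where A=A and B=F])

text \<open>Both sides are the determinant of the matrix whose rows are the columns c, d, p, q of
  \<open>E\<close>. It expands by multilinearity, and it is also a matrix of unit rows times the
  transpose of \<open>E\<close>.\<close>

lemma levi_civita_transform:
  "(\<Sum>a\<in>UNIV. \<Sum>b\<in>UNIV. \<Sum>m\<in>UNIV. \<Sum>n\<in>UNIV.
        E $ a $ c * E $ b $ d * E $ m $ p * E $ n $ q * levi_civita a b m n) = det E * levi_civita c d p q"
proof -
  have "det (vector [axis c 1, axis d 1, axis p 1, axis q 1] ** transpose E) =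
     det (vector [\<chi> a. E $ a $ c, \<chi> a. E $ a $ d, \<chi> a. E $ a $ p, \<chi> a. E $ a $ q] :: real^4^4)"
    by (rule arg_cong[where f = det])
       (simp add: vec_eq_iff forall_4 matrix_matrix_mult_def transpose_def axis_def if_distrib if_distribR cong: if_cong)
  then show ?thesis
    unfolding levi_civita_def by (simp add: det_mul det_transpose det_vector_4[of "\<chi> a. E $ a $ c"] mult.commute)
qed

section \<open>The passage to an orthonormal basis\<close>

lemma matrix_inv_eqI:
  assumes "B ** A = mat 1" "A ** B = mat 1"
  shows "matrix_inv A = B"
proof -
  have "A ** matrix_inv A = mat 1"
    unfolding matrix_inv_def by (rule someI2[of _ B]) (auto simp: assms)
  then have "B ** (A ** matrix_inv A) = B" by simp
  then show ?thesis by (simp add: matrix_mul_assoc assms)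
qed

text \<open>The formula for the inverse metric comes from inverting the orthonormality relation, as
  \<open>minkowski\<close> is its own inverse. Raising an index with g thereby becomes raising it
  with \<open>minkowski\<close> in the basis \<open>E\<close>.\<close>

lemma lorentzian_frame:
  assumes "lorentzian_metric g"
  obtains E where "invertible E" "transpose E ** g ** E = minkowski"
    "g ** matrix_inv g = mat 1" "matrix_inv g = E ** minkowski ** transpose E"
proof -
  obtain E where E: "invertible E" "transpose E ** g ** E = minkowski"
    using assms by (auto simp: lorentzian_metric_def)
  obtain E' where E': "E ** E' = mat 1" "E' ** E = mat 1"
    using E(1) by (auto simp: invertible_def)
  have "(E ** minkowski ** transpose E) ** g = (E ** minkowski ** transpose E) ** g ** (E ** E')"
    by (simp add: E')
  also have "\<dots> = E ** minkowski ** (transpose E ** g ** E) ** E'"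
    by (simp only: matrix_mul_assoc)
  also have "\<dots> = mat 1"
    by (simp only: E(2) E'(1) matrix_mul_assoc[of E minkowski minkowski, symmetric] minkowski_sq matrix_mul_rid)
  finally have 1: "(E ** minkowski ** transpose E) ** g = mat 1" .
  then have 2: "g ** (E ** minkowski ** transpose E) = mat 1"
    by (simp add: matrix_left_right_inverse)
  show ?thesis
    using that E 1 2 matrix_inv_eqI[OF 1 2] by simp
qed

lemma sandwich_nth:
  fixes F :: "'a::comm_semiring_1^'n^'m"
  shows "(A ** F ** transpose B) $ i $ j = (\<Sum>p\<in>UNIV. \<Sum>q\<in>UNIV. A $ i $ p * B $ j $ q * F $ p $ q)"
  unfolding matrix_matrix_mult_def transpose_def
  by (simp add: sum_distrib_right sum_distrib_left mult_ac) (rule sum.swap)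

text \<open>The Levi-Civita symbol picks up a factor det E, so the Hodge dual becomes the flat one
  up to \<sigma> = s sqrt |det g| det E. Determinants in the orthonormality relation give \<sigma>^2
  = 1: \<sigma> is the orientation of the basis relative to \<eta>.\<close>

lemma hodge2_frame:
  assumes vol: "metric_volume_element g \<eta>"
    and E: "transpose E ** g ** E = minkowski" "matrix_inv g = E ** minkowski ** transpose E"
  obtains \<sigma> :: real where "\<sigma>\<^sup>2 = 1"
    "\<And>F c d. (transpose (cmat E) ** hodge2 g \<eta> F ** cmat E) $ c $ d = 1/2 * (\<Sum>p\<in>UNIV. \<Sum>q\<in>UNIV.
        complex_of_real (\<sigma> * levi_civita c d p q) *
        (cmat minkowski ** (transpose (cmat E) ** F ** cmat E) ** cmat minkowski) $ p $ q)"
proof -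
  obtain s where s: "s = 1 \<or> s = -1" and \<eta>: "\<eta> = (\<chi> a b m n. s * sqrt \<bar>det g\<bar> * levi_civita a b m n)"
    using vol unfolding metric_volume_element_def by blast
  define \<sigma> where "\<sigma> = s * sqrt \<bar>det g\<bar> * det E"
  have "det minkowski = -1"
    by (simp add: det_4 minkowski_def)
  then have "det g * (det E)\<^sup>2 = -1"
    by (simp add: det_mul det_transpose power2_eq_square mult_ac flip: E(1))
  then have "\<bar>det g\<bar> * (det E)\<^sup>2 = 1"
    by (metis abs_minus abs_mult abs_one abs_power2)
  then have \<sigma>1: "\<sigma>\<^sup>2 = 1"
    using s by (auto simp: \<sigma>_def power_mult_distrib)
  have "(transpose (cmat E) ** hodge2 g \<eta> F ** cmat E) $ c $ d = 1/2 * (\<Sum>p\<in>UNIV. \<Sum>q\<in>UNIV.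
        complex_of_real (\<sigma> * levi_civita c d p q) *
        (cmat minkowski ** (transpose (cmat E) ** F ** cmat E) ** cmat minkowski) $ p $ q)" for F c d
  proof -
    \<comment> \<open>\<open>X\<close> holds the orthonormal components of \<open>F\<close> with
      both indices raised.\<close>
    define X where "X = cmat minkowski ** (transpose (cmat E) ** F ** cmat E) ** cmat minkowski"
    have "cmat (matrix_inv g) ** F ** transpose (cmat (matrix_inv g)) = cmat E ** X ** transpose (cmat E)"
      by (simp add: E(2) X_def cmat_mult cmat_transpose matrix_transpose_mul transpose_minkowski matrix_mul_assoc
          flip: cmat_transpose[of minkowski])
    from arg_cong[OF this, of "\<lambda>M. M $ _ $ _"]
    have up: "(\<Sum>p\<in>UNIV. \<Sum>q\<in>UNIV. complex_of_real (ginv g m p) * complex_of_real (ginv g n q) * F $ p $ q) =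
       (\<Sum>p\<in>UNIV. \<Sum>q\<in>UNIV. complex_of_real (E $ m $ p) * complex_of_real (E $ n $ q) * X $ p $ q)" for m n
      by (simp only: sandwich_nth cmat_nth ginv_def)
    have hodge: "hodge2 g \<eta> F $ a $ b = 1/2 * (\<Sum>m\<in>UNIV. \<Sum>n\<in>UNIV. \<eta> $ a $ b $ m $ n *
        (\<Sum>p\<in>UNIV. \<Sum>q\<in>UNIV. complex_of_real (E $ m $ p) * complex_of_real (E $ n $ q) * X $ p $ q))" for a b
      unfolding up[symmetric] by (simp add: hodge2_def sum_distrib_left mult_ac)
    have "(transpose (cmat E) ** hodge2 g \<eta> F ** cmat E) $ c $ d = (\<Sum>a\<in>UNIV. \<Sum>b\<in>UNIV. E $ a $ c * E $ b $ d * hodge2 g \<eta> F $ a $ b)"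
    proof -
      have "transpose (cmat E) $ i $ j = E $ j $ i" for i j
        by (simp add: transpose_def)
      then show ?thesis
        using sandwich_nth[of "transpose (cmat E)" "hodge2 g \<eta> F" "transpose (cmat E)" c d]
        by (simp only: transpose_transpose of_real_mult)
    qed
    also have "\<dots> = 1/2 * (\<Sum>a\<in>UNIV. \<Sum>b\<in>UNIV. \<Sum>m\<in>UNIV. \<Sum>n\<in>UNIV. \<Sum>p\<in>UNIV. \<Sum>q\<in>UNIV.
        of_real (s * sqrt \<bar>det g\<bar> * (E $ a $ c * E $ b $ d * E $ m $ p * E $ n $ q * levi_civita a b m n)) * X $ p $ q)"
      by (simp only: hodge) (simp add: \<eta> sum_distrib_left mult_ac)
    also have "\<dots> = 1/2 * (\<Sum>p\<in>UNIV. \<Sum>q\<in>UNIV. of_real (s * sqrt \<bar>det g\<bar> * (\<Sum>a\<in>UNIV. \<Sum>b\<in>UNIV. \<Sum>m\<in>UNIV. \<Sum>n\<in>UNIV.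
         E $ a $ c * E $ b $ d * E $ m $ p * E $ n $ q * levi_civita a b m n)) * X $ p $ q)"
      by (subst sum_swap_4_2) (simp only: sum_distrib_left sum_distrib_right of_real_sum)
    also have "\<dots> = 1/2 * (\<Sum>p\<in>UNIV. \<Sum>q\<in>UNIV. of_real (\<sigma> * levi_civita c d p q) * X $ p $ q)"
      by (simp only: levi_civita_transform \<sigma>_def) (simp only: mult.assoc)
    finally show ?thesis by (simp only: X_def)
  qed
  then show ?thesis using that \<sigma>1 by blast
qed

text \<open>
  An antisymmetric matrix is self-dual for the Minkowski metric iff its magnetic part is \<open>j\<close> times its
  electric part \<open>v\<close>. Here \<open>j = \<plusminus>\<i>\<close>, with the sign given by the orientation of the orthonormal basis, and the
  index 4 is the timelike one.
\<close>

definition sd_matrix :: "complex \<Rightarrow> complex^3 \<Rightarrow> complex^4^4" where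
  "sd_matrix j v = vector [
     vector [0, j * v$3, - j * v$2, v$1],
     vector [- j * v$3, 0, j * v$1, v$2],
     vector [j * v$2, - j * v$1, 0, v$3],
     vector [- v$1, - v$2, - v$3, 0]]"

lemma transpose_SD:
  assumes "F \<in> SD_bivectors g \<eta>"
  shows "transpose F = - F"
proof -
  have "- F $ a $ b = F $ b $ a" for a b
    using assms unfolding SD_bivectors_def mem_Collect_eq by metis
  then show ?thesis by (simp add: transpose_def vec_eq_iff)
qed

text \<open>Three of the self-duality equations express the components 12, 23, 13 by 34, 14, 24,
  with j = \<i> \<sigma>; antisymmetry supplies the rest.\<close>

lemma SD_bivector_frame:
  assumes vol: "metric_volume_element g \<eta>"
    and E: "transpose E ** g ** E = minkowski" "matrix_inv g = E ** minkowski ** transpose E"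
  obtains j where "j\<^sup>2 = -1" "cnj j = - j"
    "\<And>F. F \<in> SD_bivectors g \<eta> \<Longrightarrow> \<exists>v. transpose (cmat E) ** F ** cmat E = sd_matrix j v"
proof -
  obtain \<sigma> :: real where \<sigma>: "\<sigma>\<^sup>2 = 1" and
    hodge: "\<And>F c d. (transpose (cmat E) ** hodge2 g \<eta> F ** cmat E) $ c $ d = 1/2 * (\<Sum>p\<in>UNIV. \<Sum>q\<in>UNIV.
        complex_of_real (\<sigma> * levi_civita c d p q) *
        (cmat minkowski ** (transpose (cmat E) ** F ** cmat E) ** cmat minkowski) $ p $ q)"
    using hodge2_frame[OF vol E] by blast
  show ?thesis
  proof (rule that[of "\<i> * \<sigma>"])
    show "(\<i> * complex_of_real \<sigma>)\<^sup>2 = -1"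
      by (simp add: power_mult_distrib \<sigma> flip: of_real_power)
    show "cnj (\<i> * complex_of_real \<sigma>) = - (\<i> * complex_of_real \<sigma>)" by simp
    fix F assume F: "F \<in> SD_bivectors g \<eta>"
    define F' where "F' = transpose (cmat E) ** F ** cmat E"
    have "transpose F' = transpose (cmat E) ** (- F) ** cmat E"
      by (simp only: F'_def transpose_SD[OF F] matrix_transpose_mul transpose_transpose matrix_mul_assoc)
    also have "\<dots> = - F'"
      by (simp add: F'_def vec_eq_iff matrix_matrix_mult_def sum_negf)
    finally have "transpose F' = - F'" .
    have asym: "F' $ b $ a = - F' $ a $ b" for a b
      using arg_cong[OF \<open>transpose F' = - F'\<close>, of "\<lambda>M. M $ a $ b"] by (simp add: transpose_def)
    have diag: "F' $ a $ a = 0" for a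
    proof -
      have "F' $ a $ a + F' $ a $ a = 0"
        by (subst (1) asym) simp
      then show ?thesis by (simp flip: mult_2)
    qed
    have "transpose (cmat E) ** cscale2 \<i> F ** cmat E = cscale2 \<i> F'"
      by (simp add: F'_def cscale2_def vec_eq_iff matrix_matrix_mult_def sum_distrib_left mult_ac)
    moreover have "hodge2 g \<eta> F = cscale2 \<i> F"
      using F unfolding SD_bivectors_def by blast
    ultimately have "(transpose (cmat E) ** hodge2 g \<eta> F ** cmat E) $ c $ d = \<i> * F' $ c $ d" for c d
      by (simp add: cscale2_def)
    then have SD: "\<i> * F' $ c $ d = 1/2 * (\<Sum>p\<in>UNIV. \<Sum>q\<in>UNIV.
        complex_of_real (\<sigma> * levi_civita c d p q) * (cmat minkowski ** F' ** cmat minkowski) $ p $ q)" for c d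
      by (simp only: hodge F'_def)
    \<comment> \<open>Raising the timelike index 4 changes the sign, which is why the 12 component
      is j, and not -j, times the 34 component.\<close>
    have up: "(cmat minkowski ** F' ** cmat minkowski) $ p $ q = (if p = 4 then -1 else 1) * (if q = 4 then -1 else 1) * F' $ p $ q" for p q
      using exhaust_4[of p] exhaust_4[of q] by (auto simp: matrix_matrix_mult_def minkowski_def sum_4)
    have "F' $ 1 $ 2 = \<i> * \<sigma> * F' $ 3 $ 4" "F' $ 2 $ 3 = \<i> * \<sigma> * F' $ 1 $ 4" "F' $ 1 $ 3 = - \<i> * \<sigma> * F' $ 2 $ 4"
      using SD[of 1 2] SD[of 2 3] SD[of 1 3] asym[of 3 4] asym[of 1 4] asym[of 2 4]
      by (simp_all add: up sum_4 levi_civita_def det_4 axis_def complex_eq_iff)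
    then have "F' = sd_matrix (\<i> * \<sigma>) (vector [F' $ 1 $ 4, F' $ 2 $ 4, F' $ 3 $ 4])"
      using asym[of 2 1] asym[of 3 1] asym[of 3 2] asym[of 4 1] asym[of 4 2] asym[of 4 3]
      by (simp add: sd_matrix_def vec_eq_iff forall_4 diag)
    then show "\<exists>v. transpose (cmat E) ** F ** cmat E = sd_matrix (\<i> * complex_of_real \<sigma>) v"
      by (auto simp: F'_def)
  qed
qed

text \<open>With one index raised these matrices multiply like Pauli matrices: a scalar part given
  by the dot product of u and v, and a part in their cross product, which cancels on symmetrising.
  Only j^2 = -1 enters, so both orientations are covered.\<close>

lemma sd_matrix_anticommute:
  assumes "j\<^sup>2 = -1"
  shows "sd_matrix j u ** cmat minkowski ** sd_matrix j v + sd_matrix j v ** cmat minkowski ** sd_matrix j u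
    = cscale2 (2 * (u$1 * v$1 + u$2 * v$2 + u$3 * v$3)) (cmat minkowski)"
proof -
  have j: "j * (j * z) = - z" for z using assms by (simp add: power2_eq_square flip: mult.assoc)
  show ?thesis
    by (simp add: vec_eq_iff forall_4 sd_matrix_def cscale2_def matrix_matrix_mult_def sum_4 minkowski_def j algebra_simps)
qed

text \<open>The matrices for j and for -j represent the two commuting ideals of the complexified
  Lorentz algebra.\<close>

lemma sd_matrix_commute:
  assumes "j\<^sup>2 = -1"
  shows "sd_matrix j u ** cmat minkowski ** sd_matrix (- j) v = sd_matrix (- j) v ** cmat minkowski ** sd_matrix j u"
proof -
  have j: "j * (j * z) = - z" for z using assms by (simp add: power2_eq_square flip: mult.assoc)
  show ?thesis
  by (simp add: vec_eq_iff forall_4 sd_matrix_def matrix_matrix_mult_def sum_4 minkowski_def j algebra_simps)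
qed

lemma sd_matrix_trace:
  assumes "j\<^sup>2 = -1"
  shows "trace (cmat minkowski ** sd_matrix j u ** cmat minkowski ** sd_matrix (- j) v) = 0"
proof -
  have j: "j * (j * z) = - z" for z using assms by (simp add: power2_eq_square flip: mult.assoc)
  show ?thesis
    by (simp add: trace_def sd_matrix_def matrix_matrix_mult_def sum_4 minkowski_def j algebra_simps)
qed

section \<open>The algebra of self-dual bivectors\<close>

abbreviation ginv_mat :: "real^4^4 \<Rightarrow> complex^4^4" where
  "ginv_mat g \<equiv> cmat (matrix_inv g)"

text \<open>Without the factor 1/2, hence twice \<open>SD_metric\<close> on bivectors, but the
  natural pairing on symmetric tensors.\<close>

definition contract2 :: "real^4^4 \<Rightarrow> tensor2 \<Rightarrow> tensor2 \<Rightarrow> complex" where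
  "contract2 g A B = (\<Sum>a\<in>UNIV. \<Sum>b\<in>UNIV. \<Sum>m\<in>UNIV. \<Sum>n\<in>UNIV.
     A $ a $ b * complex_of_real (ginv g a m * ginv g b n) * B $ m $ n)"

lemma tdot_eq: "tdot g A B = A ** ginv_mat g ** B"
  unfolding tdot_def matrix_matrix_mult_def
  by (simp add: vec_eq_iff sum_distrib_right ginv_def)

lemma cnj2_mult: "cnj2 (A ** B) = cnj2 A ** cnj2 B"
  by (simp add: cnj2_def vec_eq_iff matrix_matrix_mult_def)

lemma cnj2_cmat [simp]: "cnj2 (cmat A) = cmat A"
  by (simp add: cnj2_def vec_eq_iff)

lemma cnj2_cnj2 [simp]: "cnj2 (cnj2 A) = A"
  by (simp add: cnj2_def vec_eq_iff)

lemma cnj2_transpose: "cnj2 (transpose A) = transpose (cnj2 A)"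
  by (simp add: cnj2_def vec_eq_iff transpose_def)

lemma cnj2_minus: "cnj2 (- A) = - cnj2 A"
  by (simp add: cnj2_def vec_eq_iff)

lemma cnj2_sd_matrix: "cnj2 (sd_matrix j v) = sd_matrix (cnj j) (\<chi> i. cnj (v $ i))"
  by (simp add: cnj2_def sd_matrix_def vec_eq_iff forall_4)

lemma trace_cnj2: "trace (cnj2 A) = cnj (trace A)"
  by (simp add: trace_def cnj2_def)

lemma trace_cscale2: "trace (cscale2 c A) = c * trace A"
  by (simp add: trace_def cscale2_def sum_distrib_left)

lemma mult_cscale2: "A ** cscale2 c B = cscale2 c (A ** B)" "cscale2 c B ** A = cscale2 c (B ** A)"
  by (simp_all add: vec_eq_iff matrix_matrix_mult_def cscale2_def sum_distrib_left mult_ac)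

lemma matrix_add_rdistrib: "(B + C) ** A = B ** A + C ** (A::'a::semiring_1^'n^'m)"
  by (simp add: vec_eq_iff matrix_matrix_mult_def sum.distrib distrib_right)

lemma matrix_mult_minus_right: "A ** (- B) = - (A ** (B::'a::ring_1^'n^'m))"
  by (simp add: vec_eq_iff matrix_matrix_mult_def sum_negf)

lemma matrix_mult_minus_left: "(- A) ** B = - (A ** (B::'a::ring_1^'n^'m))"
  by (simp add: vec_eq_iff matrix_matrix_mult_def sum_negf)

lemma sum_reverse_4:
  fixes t :: "'a \<Rightarrow> 'b \<Rightarrow> 'c \<Rightarrow> 'd \<Rightarrow> 'g::comm_monoid_add"
  shows "(\<Sum>a\<in>A. \<Sum>b\<in>B. \<Sum>m\<in>C. \<Sum>n\<in>D. t a b m n) = (\<Sum>n\<in>D. \<Sum>m\<in>C. \<Sum>b\<in>B. \<Sum>a\<in>A. t a b m n)"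
  by (simp only: sum.swap[where A=C and B=D] sum.swap[where A=B and B=D] sum.swap[where A=A and B=D]
      sum.swap[where A=B and B=C] sum.swap[where A=A and B=C] sum.swap[where A=A and B=B])

context
  fixes g :: "real^4^4" and \<eta> :: "real^4^4^4^4"
  assumes metric: "lorentzian_metric g" and vol: "metric_volume_element g \<eta>"
begin

lemma transpose_ginv_mat: "transpose (ginv_mat g) = ginv_mat g"
proof -
  obtain E where "matrix_inv g = E ** minkowski ** transpose E"
    using lorentzian_frame[OF metric] by metis
  then have "transpose (matrix_inv g) = matrix_inv g"
    by (simp add: matrix_transpose_mul matrix_mul_assoc transpose_minkowski)
  then show ?thesis by (simp flip: cmat_transpose)
qed

lemma ginv_mat_metric: "ginv_mat g ** cmat g = mat 1"
proof -
  have "g ** matrix_inv g = mat 1"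
    using lorentzian_frame[OF metric] by metis
  then have "matrix_inv g ** g = mat 1"
    by (simp add: matrix_left_right_inverse)
  then show ?thesis by (simp add: cmat_mat flip: cmat_mult)
qed

text \<open>As a trace, the full contraction becomes accessible to cyclicity and to the commutation
  rules.\<close>

lemma contract2_eq: "contract2 g A B = trace (ginv_mat g ** transpose A ** ginv_mat g ** B)"
proof -
  have "trace (ginv_mat g ** transpose A ** transpose (ginv_mat g) ** B) =
     (\<Sum>n\<in>UNIV. \<Sum>m\<in>UNIV. (ginv_mat g ** transpose A ** transpose (ginv_mat g)) $ n $ m * B $ m $ n)"
    by (simp only: trace_def matrix_matrix_mult_def[of _ B] vec_lambda_beta)
  also have "\<dots> = (\<Sum>n\<in>UNIV. \<Sum>m\<in>UNIV. \<Sum>b\<in>UNIV. \<Sum>a\<in>UNIV.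
     A $ a $ b * complex_of_real (matrix_inv g $ m $ a * matrix_inv g $ n $ b) * B $ m $ n)"
    unfolding sandwich_nth by (simp add: transpose_def sum_distrib_right sum_distrib_left mult_ac)
  also have "\<dots> = (\<Sum>n\<in>UNIV. \<Sum>m\<in>UNIV. \<Sum>b\<in>UNIV. \<Sum>a\<in>UNIV.
     A $ a $ b * complex_of_real (matrix_inv g $ a $ m * matrix_inv g $ b $ n) * B $ m $ n)"
  proof -
    have "complex_of_real (matrix_inv g $ i $ j) = complex_of_real (matrix_inv g $ j $ i)" for i j
      using arg_cong[OF transpose_ginv_mat, of "\<lambda>M. M $ j $ i"] by (simp add: transpose_def)
    then have sym: "matrix_inv g $ i $ j = matrix_inv g $ j $ i" for i j
      by (simp only: of_real_eq_iff)
    show ?thesis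
      by (intro sum.cong refl) (simp only: sym)
  qed
  finally show ?thesis
    unfolding contract2_def ginv_def transpose_ginv_mat by (subst sum_reverse_4) simp
qed

lemma SD_algebra:
  assumes X: "X \<in> SD_bivectors g \<eta>" and Y: "Y \<in> SD_bivectors g \<eta>"
  shows "\<exists>c. tdot g X Y + tdot g Y X = cscale2 c (cmat g)"
    "tdot g X (cnj2 Y) = tdot g (cnj2 Y) X"
    "trace (ginv_mat g ** tdot g X (cnj2 Y)) = 0"
proof -
  obtain E where E: "invertible E" "transpose E ** g ** E = minkowski"
    "matrix_inv g = E ** minkowski ** transpose E"
    using lorentzian_frame[OF metric] by metis
  obtain j where j: "j\<^sup>2 = -1" "cnj j = - j"
    and SD: "\<And>F. F \<in> SD_bivectors g \<eta> \<Longrightarrow> \<exists>v. transpose (cmat E) ** F ** cmat E = sd_matrix j v"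
    using SD_bivector_frame[OF vol E(2,3)] by metis
  \<comment> \<open>\<open>\<Phi>\<close> takes orthonormal components. It is injective and carries
    \<open>tdot g\<close> to the product through \<open>minkowski\<close>, so identities between
    \<open>sd_matrix\<close> values lift to tensors.\<close>
  define \<Phi> where "\<Phi> A = transpose (cmat E) ** A ** cmat E" for A
  obtain E' where "E ** E' = mat 1" using E(1) by (auto simp: invertible_def)
  then have E': "cmat E ** cmat E' = mat 1" "transpose (cmat E') ** transpose (cmat E) = mat 1"
    by (simp_all add: cmat_mat transpose_mat flip: cmat_mult cmat_transpose matrix_transpose_mul)
  have inj: "A = B" if "\<Phi> A = \<Phi> B" for A B
  proof -
    have "transpose (cmat E') ** \<Phi> C ** cmat E' = C" for C
    proof -
      have "transpose (cmat E') ** \<Phi> C ** cmat E' = (transpose (cmat E') ** transpose (cmat E)) ** C ** (cmat E ** cmat E')"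
        by (simp only: \<Phi>_def matrix_mul_assoc)
      then show ?thesis by (simp add: E')
    qed
    with that show ?thesis by metis
  qed
  have ginv: "ginv_mat g = cmat E ** cmat minkowski ** transpose (cmat E)"
    by (simp add: E(3) cmat_mult cmat_transpose)
  have \<Phi>_tdot: "\<Phi> (tdot g A B) = \<Phi> A ** cmat minkowski ** \<Phi> B" for A B
    by (simp only: \<Phi>_def tdot_eq ginv matrix_mul_assoc)
  have \<Phi>_add: "\<Phi> (A + B) = \<Phi> A + \<Phi> B" for A B
    by (simp add: \<Phi>_def matrix_add_ldistrib matrix_add_rdistrib)
  have \<Phi>_scale: "\<Phi> (cscale2 c A) = cscale2 c (\<Phi> A)" for c A
    by (simp add: \<Phi>_def mult_cscale2)
  have \<Phi>_g: "\<Phi> (cmat g) = cmat minkowski"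
    by (simp add: \<Phi>_def E(2) flip: cmat_mult cmat_transpose)
  have \<Phi>_cnj: "\<Phi> (cnj2 A) = cnj2 (\<Phi> A)" for A
    by (simp add: \<Phi>_def cnj2_mult cnj2_transpose)
  obtain u v where u: "\<Phi> X = sd_matrix j u" and v: "\<Phi> Y = sd_matrix j v"
    using SD[OF X] SD[OF Y] by (auto simp: \<Phi>_def)
  \<comment> \<open>Conjugation replaces j by -j, so \<open>cnj2 Y\<close> belongs to the other
    commuting family.\<close>
  have v': "\<Phi> (cnj2 Y) = sd_matrix (- j) (\<chi> i. cnj (v $ i))"
    by (simp add: \<Phi>_cnj v cnj2_sd_matrix j)
  show "\<exists>c. tdot g X Y + tdot g Y X = cscale2 c (cmat g)"
    by (rule exI, rule inj)
       (simp only: \<Phi>_add \<Phi>_scale \<Phi>_tdot \<Phi>_g u v sd_matrix_anticommute[OF j(1)])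
  show "tdot g X (cnj2 Y) = tdot g (cnj2 Y) X"
    by (rule inj) (simp only: \<Phi>_tdot u v' sd_matrix_commute[OF j(1)])
  have "trace (ginv_mat g ** tdot g X (cnj2 Y)) = trace (cmat E ** (cmat minkowski ** transpose (cmat E) ** tdot g X (cnj2 Y)))"
    by (simp only: ginv matrix_mul_assoc)
  also have "\<dots> = trace (cmat minkowski ** \<Phi> (tdot g X (cnj2 Y)))"
    by (subst trace_mul_sym) (simp only: \<Phi>_def matrix_mul_assoc)
  also have "\<dots> = 0"
    by (simp only: \<Phi>_tdot u v' matrix_mul_assoc sd_matrix_trace[OF j(1)])
  finally show "trace (ginv_mat g ** tdot g X (cnj2 Y)) = 0" .
qed

text \<open>The minus sign comes from transposing the antisymmetric \<open>X\<close>, the 2 from the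
  factor 1/2 in \<open>SD_metric\<close>.\<close>

lemma SD_metric_eq_trace:
  assumes "X \<in> SD_bivectors g \<eta>"
  shows "trace (ginv_mat g ** X ** ginv_mat g ** Y) = - 2 * SD_metric g X Y"
proof -
  have "2 * SD_metric g X Y = contract2 g X Y"
    by (simp add: SD_metric_def contract2_def)
  then have "2 * SD_metric g X Y = - trace (ginv_mat g ** X ** ginv_mat g ** Y)"
    by (simp add: contract2_eq transpose_SD[OF assms] matrix_mult_minus_left matrix_mult_minus_right
        trace_def sum_negf)
  then show ?thesis by (simp add: algebra_simps)
qed

text \<open>Transposition reverses the factors, with two signs that cancel; commutation of self-dual
  and conjugate factors restores the order.\<close>

lemma transpose_tdot_cnj:
  assumes X: "X \<in> SD_bivectors g \<eta>" and Y: "Y \<in> SD_bivectors g \<eta>"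
  shows "transpose (tdot g X (cnj2 Y)) = tdot g X (cnj2 Y)"
proof -
  have "transpose (tdot g X (cnj2 Y)) = tdot g (cnj2 Y) X"
    by (simp add: tdot_eq matrix_transpose_mul transpose_ginv_mat transpose_SD[OF X]
        matrix_mult_minus_left matrix_mult_minus_right transpose_SD[OF Y] matrix_mul_assoc
        cnj2_minus flip: cnj2_transpose)
  then show ?thesis using SD_algebra(2)[OF X Y] by simp
qed

lemma cnj2_tdot_cnj:
  assumes X: "X \<in> SD_bivectors g \<eta>" and Y: "Y \<in> SD_bivectors g \<eta>"
  shows "cnj2 (tdot g X (cnj2 Y)) = tdot g Y (cnj2 X)"
  using SD_algebra(2)[OF Y X] by (simp add: tdot_eq cnj2_mult)

lemma contract2_tdot_cnj:
  assumes X: "X \<in> SD_bivectors g \<eta>" and Y: "Y \<in> SD_bivectors g \<eta>"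
    and Z: "Z \<in> SD_bivectors g \<eta>" and V: "V \<in> SD_bivectors g \<eta>"
  shows "contract2 g (tdot g X (cnj2 Y)) (tdot g Z (cnj2 V)) = SD_metric g X Z * cnj (SD_metric g Y V)"
proof -
  define H where "H = ginv_mat g"
  define x y z v where "x = H ** X" and "y = H ** cnj2 Y" and "z = H ** Z" and "v = H ** cnj2 V"
  obtain c where c: "tdot g X Z + tdot g Z X = cscale2 c (cmat g)"
    using SD_algebra(1)[OF X Z] by blast
  have "x ** z + z ** x = H ** (tdot g X Z + tdot g Z X)"
    by (simp add: x_def z_def tdot_eq H_def matrix_add_ldistrib matrix_mul_assoc)
  then have xz: "x ** z + z ** x = cscale2 c (mat 1)"
    by (simp add: c mult_cscale2 H_def ginv_mat_metric)
  \<comment> \<open>The trace of the scalar identity in dimension 4 determines c: both traces on the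
    left equal -2 \<open>SD_metric g X Z\<close>.\<close>
  then have "trace (x ** z) + trace (z ** x) = 4 * c"
    by (simp add: trace_cscale2 flip: trace_add) (simp add: trace_def mat_def)
  moreover have "trace (z ** x) = trace (x ** z)"
    by (rule trace_mul_sym)
  moreover have "trace (x ** z) = - 2 * SD_metric g X Z"
    using SD_metric_eq_trace[OF X, of Z] by (simp add: x_def z_def H_def matrix_mul_assoc)
  ultimately have c_eq: "c = - SD_metric g X Z"
    by simp
  have "cnj (trace (H ** Y ** H ** V)) = trace (y ** v)"
    by (simp add: y_def v_def H_def cnj2_mult matrix_mul_assoc flip: trace_cnj2)
  then have yv: "trace (y ** v) = - 2 * cnj (SD_metric g Y V)"
    using SD_metric_eq_trace[OF Y, of V] by (simp add: H_def)
  have comm: "z ** y = y ** z" "z ** v = v ** z"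
    using SD_algebra(2)[OF Z Y] SD_algebra(2)[OF Z V]
    by (simp_all add: z_def y_def v_def tdot_eq H_def flip: matrix_mul_assoc)
  have "contract2 g (tdot g X (cnj2 Y)) (tdot g Z (cnj2 V)) = trace (x ** y ** z ** v)"
    unfolding contract2_eq transpose_tdot_cnj[OF X Y]
    by (simp add: tdot_eq x_def y_def z_def v_def H_def matrix_mul_assoc)
  also have "x ** y ** z ** v = x ** z ** y ** v"
    by (simp only: comm flip: matrix_mul_assoc)
  finally have 1: "contract2 g (tdot g X (cnj2 Y)) (tdot g Z (cnj2 V)) = trace (x ** z ** y ** v)" .
  txt \<open>Cyclicity of the trace turns \<open>x z + z x = c\<close> into \<open>2 tr(x z y v) = c tr(y v)\<close>.\<close>
  have "trace (z ** (x ** y ** v)) = trace (x ** y ** v ** z)"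
    by (rule trace_mul_sym)
  also have "x ** y ** v ** z = x ** y ** (z ** v)"
    by (simp only: comm(2) matrix_mul_assoc)
  also have "\<dots> = x ** (z ** y) ** v"
    by (simp only: comm(1) matrix_mul_assoc)
  finally have "trace (z ** x ** y ** v) = trace (x ** z ** y ** v)"
    by (simp only: matrix_mul_assoc)
  moreover have "trace (x ** z ** y ** v) + trace (z ** x ** y ** v) = trace ((x ** z + z ** x) ** (y ** v))"
    by (simp only: matrix_add_rdistrib trace_add matrix_mul_assoc)
  ultimately have "2 * trace (x ** z ** y ** v) = c * trace (y ** v)"
    by (simp add: xz mult_cscale2 trace_cscale2)
  then show ?thesis
    by (simp add: 1 yv c_eq)
qed

end

section \<open>The Bel-Robinson tensor as a bilinear expression\<close>

text \<open>The Bel-Robinson construction polarised: linear in the first tensor, antilinear in the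
  second, so that the canonical form can be expanded term by term.\<close>

definition br_prod :: "real^4^4 \<Rightarrow> tensor4 \<Rightarrow> tensor4 \<Rightarrow> tensor4" where
  "br_prod g A B = (\<chi> a m b n. \<Sum>r\<in>UNIV. \<Sum>s\<in>UNIV. \<Sum>p\<in>UNIV. \<Sum>q\<in>UNIV.
     A $ a $ p $ b $ q * complex_of_real (ginv g p r * ginv g q s) * cnj (B $ m $ r $ n $ s))"

lemma bel_robinson_eq: "bel_robinson g \<eta> W = br_prod g (SD_weyl g \<eta> W) (SD_weyl g \<eta> W)"
  by (simp add: bel_robinson_def br_prod_def)

lemma br_prod_simps:
  "br_prod g (A + B) C = br_prod g A C + br_prod g B C"
  "br_prod g (A - B) C = br_prod g A C - br_prod g B C"
  "br_prod g (c *\<^sub>C A) C = c *\<^sub>C br_prod g A C"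
  "br_prod g C (A + B) = br_prod g C A + br_prod g C B"
  "br_prod g C (A - B) = br_prod g C A - br_prod g C B"
  "br_prod g C (c *\<^sub>C A) = cnj c *\<^sub>C br_prod g C A"
  by (simp_all add: br_prod_def vec_eq_iff cscale4_def sum.distrib sum_subtractf sum_distrib_left
      algebra_simps)

text \<open>The index order pairs the first slots of the two tensors with each other, and likewise
  the third slots. Antisymmetry of \<open>Z\<close> and \<open>V\<close> brings the contracted
  indices into the position of \<open>tdot\<close>, at the price of two signs that cancel.\<close>

lemma br_prod_tensor_prod:
  assumes "transpose Z = - Z" "transpose V = - V"
  shows "br_prod g (X \<otimes> Y) (Z \<otimes> V) = tdot g X (cnj2 Z) \<otimes> tdot g Y (cnj2 V)"
proof -
  have Z: "Z $ r $ m = - Z $ m $ r" for m r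
    using arg_cong[OF assms(1), of "\<lambda>M. M $ m $ r"] by (simp add: transpose_def)
  have V: "V $ r $ m = - V $ m $ r" for m r
    using arg_cong[OF assms(2), of "\<lambda>M. M $ m $ r"] by (simp add: transpose_def)
  have Z': "tdot g X (cnj2 Z) $ a $ m = - (\<Sum>r\<in>UNIV. \<Sum>p\<in>UNIV. X $ a $ p * complex_of_real (ginv g p r) * cnj (Z $ m $ r))" for a m
    unfolding tdot_def cnj2_def vec_lambda_beta by (subst Z) (simp add: sum_negf)
  have V': "tdot g Y (cnj2 V) $ a $ m = - (\<Sum>r\<in>UNIV. \<Sum>p\<in>UNIV. Y $ a $ p * complex_of_real (ginv g p r) * cnj (V $ m $ r))" for a m
    unfolding tdot_def cnj2_def vec_lambda_beta by (subst V) (simp add: sum_negf)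
  show ?thesis
    unfolding vec_eq_iff br_prod_def tensor_prod_def vec_lambda_beta Z' V'
    by (simp only: minus_mult_minus sum_product) (simp add: mult_ac)
qed

lemma sum_swap_2_2:
  fixes t :: "'a \<Rightarrow> 'b \<Rightarrow> 'c \<Rightarrow> 'd \<Rightarrow> 'g::comm_monoid_add"
  shows "(\<Sum>a\<in>A. \<Sum>b\<in>B. \<Sum>m\<in>C. \<Sum>n\<in>D. t a b m n) = (\<Sum>m\<in>C. \<Sum>n\<in>D. \<Sum>a\<in>A. \<Sum>b\<in>B. t a b m n)"
  by (simp only: sum.swap[where A=B and B=C] sum.swap[where A=A and B=C]
      sum.swap[where A=B and B=D] sum.swap[where A=A and B=D])

lemma tensor_act_simps:
  "tensor_act g (A + B) C = tensor_act g A C + tensor_act g B C"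
  "tensor_act g (A - B) C = tensor_act g A C - tensor_act g B C"
  "tensor_act g (r *\<^sub>R A) C = r *\<^sub>R tensor_act g A C"
  "tensor_act g (X \<otimes> Y) C = cscale2 (contract2 g Y C) X"
proof -
  show "tensor_act g (X \<otimes> Y) C = cscale2 (contract2 g Y C) X"
  proof -
    have "contract2 g Y C = (\<Sum>m\<in>UNIV. \<Sum>n\<in>UNIV. \<Sum>p\<in>UNIV. \<Sum>q\<in>UNIV.
        Y $ p $ q * complex_of_real (ginv g p m * ginv g q n) * C $ m $ n)"
      unfolding contract2_def by (rule sum_swap_2_2)
    then show ?thesis
      by (simp add: vec_eq_iff tensor_act_def tensor_prod_def cscale2_def sum_distrib_left
          sum_distrib_right mult_ac)
  qed
qed (simp_all add: tensor_act_def vec_eq_iff sum.distrib sum_subtractf scaleR_sum_right algebra_simps)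

lemma linear_tensor_act: "linear (tensor_act g T)"
  by (rule linearI) (simp_all add: tensor_act_def vec_eq_iff sum.distrib scaleR_sum_right algebra_simps)

lemma contract2_simps:
  "contract2 g (A + B) C = contract2 g A C + contract2 g B C"
  "contract2 g (A - B) C = contract2 g A C - contract2 g B C"
  "contract2 g (cscale2 c A) C = c * contract2 g A C"
  "contract2 g C (A + B) = contract2 g C A + contract2 g C B"
  "contract2 g C (A - B) = contract2 g C A - contract2 g C B"
  "contract2 g C (cscale2 c A) = c * contract2 g C A"
  by (simp_all add: contract2_def cscale2_def sum.distrib sum_subtractf sum_distrib_left algebra_simps)

lemma contract2_scaleR: "contract2 g C (r *\<^sub>R A) = r *\<^sub>R contract2 g C A"
  by (simp add: contract2_def scaleR_sum_right)

text \<open>In this form the complex bilinear rules for \<open>contract2\<close> apply to real and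
  imaginary parts.\<close>

lemma Re2_eq: "Re2 A = cscale2 (1/2) (A + cnj2 A)"
  by (simp add: Re2_def cscale2_def cnj2_def vec_eq_iff complex_add_cnj)

lemma Im2_eq: "Im2 A = cscale2 (- \<i> / 2) (A - cnj2 A)"
  by (simp add: Im2_def cscale2_def cnj2_def vec_eq_iff complex_eq_iff)

section \<open>The traceless symmetric tensors spanned by a null frame\<close>

locale SD_null_frame =
  fixes g :: "real^4^4" and \<eta> :: "real^4^4^4^4" and U L K :: tensor2
  assumes metric: "lorentzian_metric g" and vol: "metric_volume_element g \<eta>"
    and frame: "null_frame g \<eta> U L K"
begin

definition "P = tdot g U (cnj2 U)"
definition "\<Lambda> = tdot g L (cnj2 L)"
definition "KK = tdot g K (cnj2 K)"
definition "N = tdot g U (cnj2 L)"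
definition "\<Omega> = tdot g U (cnj2 K)"
definition "M = tdot g L (cnj2 K)"

lemmas prod_defs = P_def \<Lambda>_def KK_def N_def \<Omega>_def M_def

lemma SD [simp]: "U \<in> SD_bivectors g \<eta>" "L \<in> SD_bivectors g \<eta>" "K \<in> SD_bivectors g \<eta>"
  using frame by (simp_all add: null_frame_def)

lemma SD_metric_sym:
  assumes "X \<in> SD_bivectors g \<eta>" "Y \<in> SD_bivectors g \<eta>"
  shows "SD_metric g X Y = SD_metric g Y X"
proof -
  have "trace ((ginv_mat g ** X) ** (ginv_mat g ** Y)) = trace ((ginv_mat g ** Y) ** (ginv_mat g ** X))"
    by (rule trace_mul_sym)
  then show ?thesis
    using SD_metric_eq_trace[OF metric vol assms(1), of Y] SD_metric_eq_trace[OF metric vol assms(2), of X]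
    by (simp add: matrix_mul_assoc)
qed

lemma frame_products [simp]:
  "SD_metric g U U = -1" "SD_metric g L K = -1" "SD_metric g K L = -1"
  "SD_metric g U L = 0" "SD_metric g U K = 0" "SD_metric g L L = 0" "SD_metric g K K = 0"
  "SD_metric g L U = 0" "SD_metric g K U = 0"
  using frame SD_metric_sym[of L K] SD_metric_sym[of U L] SD_metric_sym[of U K]
  by (simp_all add: null_frame_def)

lemma cnj2_prods:
  "cnj2 P = P" "cnj2 \<Lambda> = \<Lambda>" "cnj2 KK = KK"
  "cnj2 N = tdot g L (cnj2 U)" "cnj2 \<Omega> = tdot g K (cnj2 U)" "cnj2 M = tdot g K (cnj2 L)"
  by (simp_all add: prod_defs cnj2_tdot_cnj[OF metric vol])

lemma metric_transpose: "transpose (cmat g) = cmat g"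
  using metric by (simp add: lorentzian_metric_def flip: cmat_transpose)

lemma contract2_metric:
  "contract2 g (cmat g) A = trace (ginv_mat g ** A)"
  "contract2 g A (cmat g) = trace (ginv_mat g ** transpose A)"
  by (simp_all add: contract2_eq[OF metric vol] metric_transpose ginv_mat_metric[OF metric vol]
      flip: matrix_mul_assoc)

lemma contract2_metric_metric: "contract2 g (cmat g) (cmat g) = 4"
  by (simp add: contract2_metric metric_transpose ginv_mat_metric[OF metric vol]) (simp add: trace_def mat_def)

lemma contract2_metric_tdot:
  assumes "X \<in> SD_bivectors g \<eta>" "Y \<in> SD_bivectors g \<eta>"
  shows "contract2 g (cmat g) (tdot g X (cnj2 Y)) = 0" "contract2 g (tdot g X (cnj2 Y)) (cmat g) = 0"
  by (simp_all add: contract2_metric transpose_tdot_cnj[OF metric vol] SD_algebra(3)[OF metric vol] assms)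

lemmas contract2_table =
  contract2_simps prod_defs cnj2_tdot_cnj[OF metric vol] contract2_tdot_cnj[OF metric vol]
  contract2_metric_tdot contract2_metric_metric Re2_eq Im2_eq

end

section \<open>Real symmetric tensors and their traceless subspace\<close>

lemma subspace_traceless_symmetric: "subspace (traceless_symmetric g)"
proof (rule subspaceI)
  show "x + y \<in> traceless_symmetric g" if "x \<in> traceless_symmetric g" "y \<in> traceless_symmetric g" for x y
    using that by (auto simp: traceless_symmetric_def distrib_left sum.distrib)
  show "c *\<^sub>R x \<in> traceless_symmetric g" if "x \<in> traceless_symmetric g" for c x
  proof -
    have "(\<Sum>a\<in>UNIV. \<Sum>b\<in>UNIV. complex_of_real (ginv g a b) * (c *\<^sub>R x) $ a $ b) =
      c *\<^sub>R (\<Sum>a\<in>UNIV. \<Sum>b\<in>UNIV. complex_of_real (ginv g a b) * x $ a $ b)"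
      by (simp add: scaleR_sum_right)
    then show ?thesis
      using that by (auto simp: traceless_symmetric_def scaleR_conv_of_real[where 'a = complex])
  qed
qed (simp add: traceless_symmetric_def)

text \<open>An upper bound suffices, since ten independent elements come from the null frame and the
  metric.\<close>

lemma dim_symmetric_le: "dim {A :: tensor2. (\<forall>a b. A $ a $ b \<in> \<real>) \<and> (\<forall>a b. A $ a $ b = A $ b $ a)} \<le> 10"
proof -
  define e :: "4 \<Rightarrow> 4 \<Rightarrow> tensor2" where
    "e i j = (\<chi> a b. if (a = i \<and> b = j) \<or> (a = j \<and> b = i) then 1 else 0)" for i j
  define B where "B = {e 1 1, e 1 2, e 1 3, e 1 4, e 2 2, e 2 3, e 2 4, e 3 3, e 3 4, e 4 4}"
  have "A \<in> span B" if A: "\<And>a b. A $ a $ b \<in> \<real>" "\<And>a b. A $ a $ b = A $ b $ a" for A :: tensor2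
  proof -
    have re: "complex_of_real (Re (A $ a $ b)) = A $ a $ b" for a b
      by (rule of_real_Re[OF A(1)])
    have "A = Re (A$1$1) *\<^sub>R e 1 1 + Re (A$1$2) *\<^sub>R e 1 2 + Re (A$1$3) *\<^sub>R e 1 3 + Re (A$1$4) *\<^sub>R e 1 4
      + Re (A$2$2) *\<^sub>R e 2 2 + Re (A$2$3) *\<^sub>R e 2 3 + Re (A$2$4) *\<^sub>R e 2 4
      + Re (A$3$3) *\<^sub>R e 3 3 + Re (A$3$4) *\<^sub>R e 3 4 + Re (A$4$4) *\<^sub>R e 4 4"
      by (simp add: vec_eq_iff forall_4 e_def scaleR_conv_of_real[where 'a = complex] re A(2)[of 2 1] A(2)[of 3 1]
          A(2)[of 4 1] A(2)[of 3 2] A(2)[of 4 2] A(2)[of 4 3])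
    moreover have "\<dots> \<in> span B"
      unfolding B_def by (intro span_add span_scale span_base) simp_all
    ultimately show ?thesis by simp
  qed
  then have "{A :: tensor2. (\<forall>a b. A $ a $ b \<in> \<real>) \<and> (\<forall>a b. A $ a $ b = A $ b $ a)} \<subseteq> span B"
    by blast
  then have "dim {A :: tensor2. (\<forall>a b. A $ a $ b \<in> \<real>) \<and> (\<forall>a b. A $ a $ b = A $ b $ a)} \<le> card B"
    by (rule dim_le_card) (simp add: B_def)
  \<comment> \<open>Bounding the cardinality by the length of a list avoids proving the ten matrices
    distinct.\<close>
  also have "\<dots> \<le> length [e 1 1, e 1 2, e 1 3, e 1 4, e 2 2, e 2 3, e 2 4, e 3 3, e 3 4, e 4 4]"
    using card_length[of "[e 1 1, e 1 2, e 1 3, e 1 4, e 2 2, e 2 3, e 2 4, e 3 3, e 3 4, e 4 4]"]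
    by (simp add: B_def)
  finally show ?thesis by simp
qed

context SD_null_frame
begin

definition "basis_list = [P, \<Lambda>, KK, Re2 M, Im2 M, Re2 N, Re2 \<Omega>, Im2 N, Im2 \<Omega>]"

lemma trace_ginv:
  assumes "\<forall>a b. A $ a $ b = A $ b $ a"
  shows "(\<Sum>a\<in>UNIV. \<Sum>b\<in>UNIV. complex_of_real (ginv g a b) * A $ a $ b) = contract2 g (cmat g) A"
proof -
  have "(\<Sum>a\<in>UNIV. \<Sum>b\<in>UNIV. complex_of_real (ginv g a b) * A $ a $ b) =
     (\<Sum>a\<in>UNIV. \<Sum>b\<in>UNIV. complex_of_real (ginv g a b) * A $ b $ a)"
    by (intro sum.cong refl) (metis assms)
  then show ?thesis
    by (simp add: contract2_metric trace_def matrix_matrix_mult_def ginv_def)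
qed

lemma traceless_symmetric_iff:
  "A \<in> traceless_symmetric g \<longleftrightarrow> (\<forall>a b. A $ a $ b \<in> \<real>) \<and> (\<forall>a b. A $ a $ b = A $ b $ a) \<and>
     contract2 g (cmat g) A = 0"
  unfolding traceless_symmetric_def mem_Collect_eq using trace_ginv by auto

lemma tdot_cnj_traceless_symmetric:
  assumes "X \<in> SD_bivectors g \<eta>" "Y \<in> SD_bivectors g \<eta>"
  shows "Re2 (tdot g X (cnj2 Y)) \<in> traceless_symmetric g" "Im2 (tdot g X (cnj2 Y)) \<in> traceless_symmetric g"
proof -
  have "tdot g X (cnj2 Y) $ a $ b = tdot g X (cnj2 Y) $ b $ a" for a b
    using arg_cong[OF transpose_tdot_cnj[OF metric vol assms], of "\<lambda>M. M $ b $ a"] by (simp add: transpose_def)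
  then have sym: "\<forall>a b. Re2 (tdot g X (cnj2 Y)) $ a $ b = Re2 (tdot g X (cnj2 Y)) $ b $ a"
    "\<forall>a b. Im2 (tdot g X (cnj2 Y)) $ a $ b = Im2 (tdot g X (cnj2 Y)) $ b $ a"
    unfolding Re2_def Im2_def vec_lambda_beta by metis+
  have "contract2 g (cmat g) (Re2 (tdot g X (cnj2 Y))) = 0" "contract2 g (cmat g) (Im2 (tdot g X (cnj2 Y))) = 0"
    by (simp_all add: Re2_eq Im2_eq contract2_simps cnj2_tdot_cnj[OF metric vol] contract2_metric_tdot assms)
  with sym show "Re2 (tdot g X (cnj2 Y)) \<in> traceless_symmetric g" "Im2 (tdot g X (cnj2 Y)) \<in> traceless_symmetric g"
    unfolding traceless_symmetric_iff by (simp_all add: Re2_def Im2_def)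
qed

lemma Re2_prods: "Re2 P = P" "Re2 \<Lambda> = \<Lambda>" "Re2 KK = KK"
  by (simp_all add: Re2_eq cnj2_prods) (simp_all add: cscale2_def vec_eq_iff)

lemma basis_traceless_symmetric: "set basis_list \<subseteq> traceless_symmetric g"
proof -
  have "{Re2 P, Re2 \<Lambda>, Re2 KK, Re2 M, Im2 M, Re2 N, Re2 \<Omega>, Im2 N, Im2 \<Omega>} \<subseteq> traceless_symmetric g"
    unfolding prod_defs by (simp add: tdot_cnj_traceless_symmetric)
  then show ?thesis by (simp add: basis_list_def Re2_prods)
qed

lemma independent_basis_list: "independent (set (cmat g # basis_list))" "distinct (cmat g # basis_list)"
proof -
  define bs where "bs = cmat g # basis_list"
  \<comment> \<open>The dual partners, in the order of \<open>bs\<close>. As L pairs only with K,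
    \<open>\<Lambda>\<close> pairs with \<open>KK\<close> and \<open>N\<close> with
    \<open>\<Omega>\<close>; M pairs with its own conjugate, so \<open>Re2 M\<close> and
    \<open>Im2 M\<close> are their own partners.\<close>
  define ds where "ds = [cmat g, P, KK, \<Lambda>, Re2 M, Im2 M, Re2 \<Omega>, Re2 N, Im2 \<Omega>, Im2 N]"
  have len: "length bs = 10" by (simp add: bs_def basis_list_def)
  have gram: "\<forall>i<10. Re (contract2 g (ds ! i) (bs ! i)) \<noteq> 0 \<and> (\<forall>j<10. i \<noteq> j \<longrightarrow> Re (contract2 g (ds ! i) (bs ! j)) = 0)"
    by (simp add: eval_nat_numeral All_less_Suc bs_def ds_def basis_list_def contract2_table)
  have lin: "linear (\<lambda>x. Re (contract2 g (ds ! i) x))" for i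
    by (rule linearI) (simp_all add: contract2_simps contract2_scaleR)
  have "independent ((!) bs ` {..<10})" "inj_on ((!) bs) {..<10}"
    using independent_by_duality[of 10 "\<lambda>i x. Re (contract2 g (ds ! i) x)" "(!) bs", OF lin] gram by blast+
  moreover have "(!) bs ` {..<10} = set bs"
    using len by (auto simp: set_conv_nth)
  ultimately show "independent (set (cmat g # basis_list))" "distinct (cmat g # basis_list)"
    using len by (simp_all add: bs_def[symmetric] distinct_conv_nth inj_on_def) blast
qed

lemma span_basis_list: "span (set basis_list) = traceless_symmetric g"
proof
  show "span (set basis_list) \<subseteq> traceless_symmetric g"
    by (rule span_minimal[OF basis_traceless_symmetric subspace_traceless_symmetric])
  define V :: "tensor2 set" where "V = {A. (\<forall>a b. A $ a $ b \<in> \<real>) \<and> (\<forall>a b. A $ a $ b = A $ b $ a)}"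
  have sub: "traceless_symmetric g \<subseteq> V"
    by (auto simp: V_def traceless_symmetric_def)
  have "g $ a $ b = g $ b $ a" for a b
  proof -
    have "transpose g = g" using metric by (simp add: lorentzian_metric_def)
    from arg_cong[OF this, of "\<lambda>M. M $ a $ b"] show ?thesis by (simp add: transpose_def)
  qed
  then have "cmat g \<in> V"
    unfolding V_def by simp
  then have "set (cmat g # basis_list) \<subseteq> V"
    using basis_traceless_symmetric sub by auto
  moreover have "dim V \<le> card (set (cmat g # basis_list))"
    using dim_symmetric_le distinct_card[OF independent_basis_list(2)] by (simp add: V_def basis_list_def)
  ultimately have V: "V \<subseteq> span (set (cmat g # basis_list))"
    using card_ge_dim_independent[OF _ independent_basis_list(1)] by blast
  show "traceless_symmetric g \<subseteq> span (set basis_list)"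
  proof
    fix A assume A: "A \<in> traceless_symmetric g"
    then have "A \<in> span (insert (cmat g) (set basis_list))"
      using V sub by auto
    then obtain k where k: "A - k *\<^sub>R cmat g \<in> span (set basis_list)"
      by (auto simp: span_insert)
    then have "A - k *\<^sub>R cmat g \<in> traceless_symmetric g"
      using \<open>span (set basis_list) \<subseteq> traceless_symmetric g\<close> by blast
    \<comment> \<open>Contraction with the metric vanishes on both tensors and takes the value 4 on
      the metric itself, which forces k = 0.\<close>
    then have "contract2 g (cmat g) (A - k *\<^sub>R cmat g) = 0" "contract2 g (cmat g) A = 0"
      using A by (simp_all add: traceless_symmetric_iff)
    then have "k = 0"
      by (simp add: contract2_simps contract2_scaleR contract2_metric_metric)
    with k show "A \<in> span (set basis_list)" by simp
  qed
qed

end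

section \<open>The spectrum of the Bel-Robinson tensor\<close>

locale petrov_II_frame = SD_null_frame +
  fixes W :: "real^4^4^4^4" and \<rho> :: complex
  assumes \<rho>: "\<rho> \<noteq> 0" and canonical: "SD_weyl g \<eta> W = (2 * \<rho>) *\<^sub>C (U \<otimes> U) - \<rho> *\<^sub>C (L \<otimes>\<^sub>s K) + \<rho> *\<^sub>C (L \<otimes> L)"
begin

definition "t = (cmod \<rho>)\<^sup>2"
definition "f = tensor_act g (bel_robinson g \<eta> W)"

text \<open>Every coefficient is a multiple of \<rho> cnj \<rho> = t: 4t from the U term with
  itself, 2t up to sign from its cross terms, t up to sign from the terms in L and K.\<close>

lemma bel_robinson_canonical:
  "bel_robinson g \<eta> W = (4 * t) *\<^sub>R (P \<otimes> P)
         - (2 * t) *\<^sub>R (\<Omega> \<otimes>\<^sub>s N + cnj2 \<Omega> \<otimes>\<^sub>s cnj2 N - N \<otimes> N - cnj2 N \<otimes> cnj2 N)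
         + t *\<^sub>R (\<Lambda> \<otimes>\<^sub>s KK + M \<otimes>\<^sub>s cnj2 M - \<Lambda> \<otimes>\<^sub>s cnj2 M - \<Lambda> \<otimes>\<^sub>s M + \<Lambda> \<otimes> \<Lambda>)"
proof -
  have \<rho>\<rho>: "\<rho> * (cnj \<rho> * z) = of_real t * z" for z
    using complex_norm_square[of \<rho>] by (simp add: t_def flip: mult.assoc)
  have tr: "transpose U = - U" "transpose L = - L" "transpose K = - K"
    using transpose_SD SD by blast+
  show ?thesis
    unfolding bel_robinson_eq canonical cnj2_prods unfolding prod_defs
    by (simp add: br_prod_simps sym_tensor_prod_def br_prod_tensor_prod tr)
       (simp add: vec_eq_iff cscale4_def tensor_prod_def scaleR_conv_of_real[where 'a = complex] \<rho>\<rho> algebra_simps)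
qed

lemma linear_f: "linear f"
  by (simp add: f_def linear_tensor_act)

lemma f_apply: "f A = cscale2 (4 * t * contract2 g P A) P
   - cscale2 (2 * t * contract2 g N A) (\<Omega> - N) - cscale2 (2 * t * contract2 g \<Omega> A) N
   - cscale2 (2 * t * contract2 g (cnj2 N) A) (cnj2 \<Omega> - cnj2 N) - cscale2 (2 * t * contract2 g (cnj2 \<Omega>) A) (cnj2 N)
   + cscale2 (t * contract2 g KK A) \<Lambda> + cscale2 (t * contract2 g \<Lambda> A) (KK - M - cnj2 M + \<Lambda>)
   + cscale2 (t * contract2 g (cnj2 M) A) (M - \<Lambda>) + cscale2 (t * contract2 g M A) (cnj2 M - \<Lambda>)"
  unfolding f_def bel_robinson_canonical sym_tensor_prod_def
  by (simp add: tensor_act_simps) (simp add: vec_eq_iff cscale2_def scaleR_conv_of_real[where 'a = complex] algebra_simps)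

text \<open>The complex relation behind the rows for M is T(M) = t (M - \<Lambda>). As \<Lambda> is
  real, it drops out of the imaginary part, so \<open>Im2 M\<close> splits off as an eigentensor
  while \<open>Re2 M\<close> stays in a block with \<open>\<Lambda>\<close>.\<close>

lemma f_basis:
  "f P = (4 * t) *\<^sub>R P" "f (Im2 M) = t *\<^sub>R Im2 M"
  "f \<Lambda> = t *\<^sub>R \<Lambda>" "f (Re2 M) = t *\<^sub>R Re2 M + (- t) *\<^sub>R \<Lambda>"
  "f KK = t *\<^sub>R KK + (- 2 * t) *\<^sub>R Re2 M + t *\<^sub>R \<Lambda>"
  "f (Re2 N) = (- 2 * t) *\<^sub>R Re2 N" "f (Re2 \<Omega>) = (- 2 * t) *\<^sub>R Re2 \<Omega> + (2 * t) *\<^sub>R Re2 N"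
  "f (Im2 N) = (- 2 * t) *\<^sub>R Im2 N" "f (Im2 \<Omega>) = (- 2 * t) *\<^sub>R Im2 \<Omega> + (2 * t) *\<^sub>R Im2 N"
  unfolding f_apply
  by (simp_all add: contract2_table, simp_all add: vec_eq_iff cscale2_def scaleR_conv_of_real[where 'a = complex] algebra_simps)

end

section \<open>Jordan blocks and multiplicities\<close>

context petrov_II_frame
begin

lemma t_pos: "t > 0"
  using \<rho> by (simp add: t_def)

lemma independent_subset:
  assumes "B \<subseteq> set basis_list"
  shows "independent B" "finite B"
  using independent_mono[OF independent_basis_list(1), of B] assms finite_subset[OF assms] by auto

lemma distinct_basis: "distinct basis_list"
  using independent_basis_list(2) by simp

lemma invariant_blocks:
  "invariant_space f (span {\<Lambda>, Re2 M, KK})" "dim (span {\<Lambda>, Re2 M, KK}) = 3"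
  "sole_eigenvector f (span {\<Lambda>, Re2 M, KK}) \<Lambda>"
  "\<And>x. x \<in> span {\<Lambda>, Re2 M, KK} \<Longrightarrow> ((\<lambda>v. f v - t *\<^sub>R v) ^^ 3) x = 0"
  "invariant_space f (span {Re2 N, Re2 \<Omega>})" "dim (span {Re2 N, Re2 \<Omega>}) = 2"
  "sole_eigenvector f (span {Re2 N, Re2 \<Omega>}) (Re2 N)"
  "\<And>x. x \<in> span {Re2 N, Re2 \<Omega>} \<Longrightarrow> ((\<lambda>v. f v - (- 2 * t) *\<^sub>R v) ^^ 2) x = 0"
  "invariant_space f (span {Im2 N, Im2 \<Omega>})" "dim (span {Im2 N, Im2 \<Omega>}) = 2"
  "sole_eigenvector f (span {Im2 N, Im2 \<Omega>}) (Im2 N)"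
  "\<And>x. x \<in> span {Im2 N, Im2 \<Omega>} \<Longrightarrow> ((\<lambda>v. f v - (- 2 * t) *\<^sub>R v) ^^ 2) x = 0"
proof -
  have ind: "independent {\<Lambda>, Re2 M, KK}" "independent {Re2 N, Re2 \<Omega>}" "independent {Im2 N, Im2 \<Omega>}"
    by (rule independent_subset, simp add: basis_list_def)+
  have ne: "\<Lambda> \<noteq> Re2 M" "\<Lambda> \<noteq> KK" "Re2 M \<noteq> KK" "Re2 N \<noteq> Re2 \<Omega>" "Im2 N \<noteq> Im2 \<Omega>"
    using distinct_basis by (auto simp: basis_list_def)
  \<comment> \<open>The entries next to the diagonal: -t and -2t in the block of length 3, 2t in
    each block of length 2.\<close>
  have nz: "- t \<noteq> 0" "- 2 * t \<noteq> 0" "2 * t \<noteq> 0"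
    using t_pos by simp_all
  note b = jordan_block_3[OF linear_f ind(1) ne(1-3) f_basis(3-5) nz(1,2)]
    jordan_block_2[OF linear_f ind(2) ne(4) f_basis(6,7) nz(3)]
    jordan_block_2[OF linear_f ind(3) ne(5) f_basis(8,9) nz(3)]
  show "invariant_space f (span {\<Lambda>, Re2 M, KK})" "dim (span {\<Lambda>, Re2 M, KK}) = 3"
  "sole_eigenvector f (span {\<Lambda>, Re2 M, KK}) \<Lambda>"
  "\<And>x. x \<in> span {\<Lambda>, Re2 M, KK} \<Longrightarrow> ((\<lambda>v. f v - t *\<^sub>R v) ^^ 3) x = 0"
  "invariant_space f (span {Re2 N, Re2 \<Omega>})" "dim (span {Re2 N, Re2 \<Omega>}) = 2"
  "sole_eigenvector f (span {Re2 N, Re2 \<Omega>}) (Re2 N)"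
  "\<And>x. x \<in> span {Re2 N, Re2 \<Omega>} \<Longrightarrow> ((\<lambda>v. f v - (- 2 * t) *\<^sub>R v) ^^ 2) x = 0"
  "invariant_space f (span {Im2 N, Im2 \<Omega>})" "dim (span {Im2 N, Im2 \<Omega>}) = 2"
  "sole_eigenvector f (span {Im2 N, Im2 \<Omega>}) (Im2 N)"
  "\<And>x. x \<in> span {Im2 N, Im2 \<Omega>} \<Longrightarrow> ((\<lambda>v. f v - (- 2 * t) *\<^sub>R v) ^^ 2) x = 0"
    by (fact b)+
qed

text \<open>The exponents 1, 3 and 2 are the lengths of the longest Jordan blocks for 4t, t and
  -2t.\<close>

lemma gen_eigenspaces:
  "gen_eigenspace scaleR f (traceless_symmetric g) (4 * t) = span {P}"
  "gen_eigenspace scaleR f (traceless_symmetric g) t = span {Im2 M, \<Lambda>, Re2 M, KK}"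
  "gen_eigenspace scaleR f (traceless_symmetric g) (- 2 * t) = span {Re2 N, Re2 \<Omega>, Im2 N, Im2 \<Omega>}"
proof -
  let ?A = "{P}" and ?B = "{Im2 M, \<Lambda>, Re2 M, KK}" and ?C = "{Re2 N, Re2 \<Omega>, Im2 N, Im2 \<Omega>}"
  have A: "((\<lambda>v. f v - (4 * t) *\<^sub>R v) ^^ 1) x = 0" if "x \<in> span ?A" for x
    by (rule nilpotent_on_span[OF linear_f _ that]) (simp add: f_basis)
  have B: "((\<lambda>v. f v - t *\<^sub>R v) ^^ 3) x = 0" if "x \<in> span ?B" for x
  proof (rule nilpotent_on_span[OF linear_f _ that])
    have "((\<lambda>v. f v - t *\<^sub>R v) ^^ 3) (Im2 M) = 0"
      by (simp add: numeral_3_eq_3 f_basis linear_0[OF linear_f])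
    then show "((\<lambda>v. f v - t *\<^sub>R v) ^^ 3) x = 0" if "x \<in> ?B" for x
      using that invariant_blocks(4) by (auto simp: span_base)
  qed
  have C: "((\<lambda>v. f v - (- 2 * t) *\<^sub>R v) ^^ 2) x = 0" if "x \<in> span ?C" for x
  proof (rule nilpotent_on_span[OF linear_f _ that])
    show "((\<lambda>v. f v - (- 2 * t) *\<^sub>R v) ^^ 2) x = 0" if "x \<in> ?C" for x
      using that invariant_blocks(8)[OF span_base] invariant_blocks(12)[OF span_base] by blast
  qed
  have sub: "span ?A \<subseteq> traceless_symmetric g" "span ?B \<subseteq> traceless_symmetric g" "span ?C \<subseteq> traceless_symmetric g"
    unfolding span_basis_list[symmetric] by (rule span_mono, simp add: basis_list_def)+
  have decomp: "\<exists>a\<in>span ?A. \<exists>b\<in>span ?B. \<exists>c\<in>span ?C. x = a + (b + c)" if "x \<in> traceless_symmetric g" for x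
  proof -
    have "set basis_list = ?A \<union> (?B \<union> ?C)"
      by (auto simp: basis_list_def)
    then have "x \<in> span (?A \<union> (?B \<union> ?C))"
      using that span_basis_list by simp
    then show ?thesis
      unfolding span_Un by blast
  qed
  have ne: "4 * t \<noteq> t" "4 * t \<noteq> - 2 * t" "t \<noteq> - 2 * t"
    using t_pos by simp_all
  show "gen_eigenspace scaleR f (traceless_symmetric g) (4 * t) = span ?A"
    by (rule gen_eigenspace_eq_summand[OF linear_f ne(1,2) decomp sub(1) A B C])
  show "gen_eigenspace scaleR f (traceless_symmetric g) t = span ?B"
  \<comment> \<open>\<open>gen_eigenspace_eq_summand\<close> isolates the first summand, so the
    decomposition is reordered to put the wanted one in front.\<close>
  proof (rule gen_eigenspace_eq_summand[OF linear_f ne(1)[symmetric] ne(3) _ sub(2) B A C])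
    show "\<exists>b\<in>span ?B. \<exists>a\<in>span ?A. \<exists>c\<in>span ?C. x = b + (a + c)" if x: "x \<in> traceless_symmetric g" for x
    proof -
      obtain a b c where "a \<in> span ?A" "b \<in> span ?B" "c \<in> span ?C" "x = a + (b + c)"
        using decomp[OF x] by blast
      moreover from this(4) have "x = b + (a + c)" by (simp only: add.left_commute)
      ultimately show ?thesis by blast
    qed
  qed
  show "gen_eigenspace scaleR f (traceless_symmetric g) (- 2 * t) = span ?C"
  proof (rule gen_eigenspace_eq_summand[OF linear_f ne(2,3)[symmetric] _ sub(3) C A B])
    show "\<exists>c\<in>span ?C. \<exists>a\<in>span ?A. \<exists>b\<in>span ?B. x = c + (a + b)" if x: "x \<in> traceless_symmetric g" for x
    proof -
      obtain a b c where "a \<in> span ?A" "b \<in> span ?B" "c \<in> span ?C" "x = a + (b + c)"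
        using decomp[OF x] by blast
      moreover from this(4) have "x = c + (a + b)" by (simp only: add_ac)
      ultimately show ?thesis by blast
    qed
  qed
qed

lemma multiplicities:
  "alg_mult scaleR f (traceless_symmetric g) (4 * t) = 1"
  "alg_mult scaleR f (traceless_symmetric g) t = 4"
  "alg_mult scaleR f (traceless_symmetric g) (- 2 * t) = 4"
proof -
  have "independent {P}" "independent {Im2 M, \<Lambda>, Re2 M, KK}" "independent {Re2 N, Re2 \<Omega>, Im2 N, Im2 \<Omega>}"
    by (rule independent_subset, simp add: basis_list_def)+
  moreover have "card {P} = 1" "card {Im2 M, \<Lambda>, Re2 M, KK} = 4" "card {Re2 N, Re2 \<Omega>, Im2 N, Im2 \<Omega>} = 4"
    using distinct_basis by (auto simp: basis_list_def card_insert_if)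
  ultimately show "alg_mult scaleR f (traceless_symmetric g) (4 * t) = 1"
    "alg_mult scaleR f (traceless_symmetric g) t = 4"
    "alg_mult scaleR f (traceless_symmetric g) (- 2 * t) = 4"
    unfolding alg_mult_real gen_eigenspaces by (metis dim_span_eq_card_independent)+
qed

lemma eigenvectors:
  "eigenvector_on scaleR f (traceless_symmetric g) (4 * t) P"
  "eigenvector_on scaleR f (traceless_symmetric g) t (Im2 M)"
proof -
  have "0 \<notin> set basis_list"
    using independent_subset(1)[OF order_refl] real_vector.dependent_zero by blast
  then have "P \<noteq> 0" "Im2 M \<noteq> 0"
    by (auto simp: basis_list_def)
  moreover have "P \<in> traceless_symmetric g" "Im2 M \<in> traceless_symmetric g"
    using basis_traceless_symmetric by (simp_all add: basis_list_def)
  ultimately show "eigenvector_on scaleR f (traceless_symmetric g) (4 * t) P"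
    "eigenvector_on scaleR f (traceless_symmetric g) t (Im2 M)"
    by (simp_all only: eigenvector_on_def f_basis) simp_all
qed

end

theorem proposition9:
  fixes g :: "real^4^4" and \<eta> W :: "real^4^4^4^4" and \<rho> :: complex and t :: real
    and U L K P \<Lambda> KK N \<Omega> M :: tensor2
    and T :: tensor4 and f :: "tensor2 \<Rightarrow> tensor2"
    and S Qt QR QI :: "tensor2 set"
  assumes metric: "lorentzian_metric g"
    and vol: "metric_volume_element g \<eta>"
    and weyl: "weyl_tensor g W"
    and type_II: "petrov_type_II g \<eta> W"
    and frame: "null_frame g \<eta> U L K"
    and \<rho>: "\<rho> \<noteq> 0"
    and canonical: "SD_weyl g \<eta> W =
          (2 * \<rho>) *\<^sub>C (U \<otimes> U) - \<rho> *\<^sub>C (L \<otimes>\<^sub>s K) + \<rho> *\<^sub>C (L \<otimes> L)"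
    and t: "t = (cmod \<rho>)\<^sup>2"
    and P: "P = tdot g U (cnj2 U)"
    and \<Lambda>: "\<Lambda> = tdot g L (cnj2 L)"
    and KK: "KK = tdot g K (cnj2 K)"
    and N: "N = tdot g U (cnj2 L)"
    and \<Omega>: "\<Omega> = tdot g U (cnj2 K)"
    and M: "M = tdot g L (cnj2 K)"
    and T: "T = bel_robinson g \<eta> W"
    and f: "f = tensor_act g T"
    and S: "S = traceless_symmetric g"
    and Qt: "Qt = span {\<Lambda>, Re2 M, KK}"
    and QR: "QR = span {Re2 N, Re2 \<Omega>}"
    and QI: "QI = span {Im2 N, Im2 \<Omega>}"
  shows
    "T = (4 * t) *\<^sub>R (P \<otimes> P)
         - (2 * t) *\<^sub>R (\<Omega> \<otimes>\<^sub>s N + cnj2 \<Omega> \<otimes>\<^sub>s cnj2 N - N \<otimes> N - cnj2 N \<otimes> cnj2 N)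
         + t *\<^sub>R (\<Lambda> \<otimes>\<^sub>s KK + M \<otimes>\<^sub>s cnj2 M - \<Lambda> \<otimes>\<^sub>s cnj2 M - \<Lambda> \<otimes>\<^sub>s M + \<Lambda> \<otimes> \<Lambda>)
     \<and> alg_mult scaleR f S (4 * t) = 1 \<and> eigenvector_on scaleR f S (4 * t) P
     \<and> alg_mult scaleR f S t = 4 \<and> eigenvector_on scaleR f S t (Im2 M)
     \<and> invariant_space f Qt \<and> dim Qt = 3 \<and> sole_eigenvector f Qt \<Lambda>
     \<and> gen_eigenspace scaleR f S t = span (insert (Im2 M) Qt)
     \<and> alg_mult scaleR f S (- 2 * t) = 4
     \<and> invariant_space f QR \<and> dim QR = 2 \<and> sole_eigenvector f QR (Re2 N)
     \<and> invariant_space f QI \<and> dim QI = 2 \<and> sole_eigenvector f QI (Im2 N)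
     \<and> gen_eigenspace scaleR f S (- 2 * t) = span (QR \<union> QI)"
proof -
  interpret frame: petrov_II_frame g \<eta> U L K W \<rho>
    by unfold_locales (fact metric vol frame \<rho> canonical)+
  note ids = P \<Lambda> KK N \<Omega> M t f T S Qt QR QI
  note defs = frame.P_def frame.\<Lambda>_def frame.KK_def frame.N_def frame.\<Omega>_def frame.M_def
    frame.t_def
  have eqs: "P = frame.P" "\<Lambda> = frame.\<Lambda>" "KK = frame.KK" "N = frame.N" "\<Omega> = frame.\<Omega>" "M = frame.M"
    "t = frame.t" "f = frame.f"
    by (simp_all only: ids defs frame.f_def)
  have spans: "span (insert (Im2 M) Qt) = span {Im2 M, \<Lambda>, Re2 M, KK}"
    "span (QR \<union> QI) = span {Re2 N, Re2 \<Omega>, Im2 N, Im2 \<Omega>}"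
    unfolding Qt QR QI span_Un_span span_insert_span by (simp_all add: insert_commute)
  show ?thesis
    unfolding spans unfolding Qt QR QI S eqs T
    by (intro conjI frame.bel_robinson_canonical frame.invariant_blocks frame.gen_eigenspaces frame.multiplicities
        frame.eigenvectors)
qed

end
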